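(* Let $3\leq\delta\leq n\leq m$ and put $\ell=n-\delta+1$. Let $b\in\mathbb{N}$ be a common divisor of $m$ and $\ell+1$. Let $q$ be a prime power. Then there exists a maximal $[\mathcal{F};\delta]_q$-code, where $\mathcal{F}$ is the $m\times n$-Ferrers diagram $$\mathcal{F}=[\underbrace{b,\ldots,b}_{\ell-b+1},\underbrace{\ell+1,\ldots,\ell+1}_{b},\underbrace{m,\ldots,m}_{\delta-2}].$$
   Context: $[n]=\{1,\ldots,n\}$. An $m\times n$-Ferrers diagram is a set $\mathcal{F}\subseteq[m]\times[n]$ such that $(i,j)\in\mathcal{F}$, $j<n$ implies $(i,j+1)\in\mathcal{F}$, and $(i,j)\in\mathcal{F}$, $i>1$ implies $(i-1,j)\in\mathcal{F}$. It is identified with $[c_1,\ldots,c_n]$, where $c_j$ is the number of elements of $\mathcal{F}$ in column $j$ (so $\mathcal{F}=\{(i,j): 1\le i\le c_j\}$). An $[\mathcal{F};\delta]_q$-code is an $\mathbb{F}_q$-subspace of $\mathbb{F}_q^{m\times n}$, all of whose matrices have their nonzero entries only at positions in $\mathcal{F}$, with rank distance $\delta$, i.e. the minimum rank of its nonzero matrices is $\delta$. For $j=0,\ldots,\delta-1$ put $\nu_j(\mathcal{F};\delta)=\sum_{t=1}^{n-\delta+1+j}\max\{c_t-j,0\}$ and $\nu_{\min}(\mathcal{F};\delta)=\min\{\nu_0,\ldots,\nu_{\delta-1}\}$. An $[\mathcal{F};\delta]_q$-code is maximal if its $\mathbb{F}_q$-dimension is $\nu_{\min}(\mathcal{F};\delta)$.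 *)

theory Defs
  imports
    "Jordan_Normal_Form.DL_Rank"
    "HOL-Number_Theory.Prime_Powers"
    "HOL-Library.Cardinality"
begin

section \<open>Ferrers diagrams\<close>

text \<open>Positions are pairs (row, column), both counted from 1.\<close>

definition ferrers_diagram :: "nat \<Rightarrow> nat \<Rightarrow> (nat \<times> nat) set \<Rightarrow> bool" where
  "ferrers_diagram m n F \<longleftrightarrow>
     F \<subseteq> {1..m} \<times> {1..n} \<and>
     (\<forall>i j. (i, j) \<in> F \<and> j < n \<longrightarrow> (i, j + 1) \<in> F) \<and>
     (\<forall>i j. (i, j) \<in> F \<and> i > 1 \<longrightarrow> (i - 1, j) \<in> F)"

definition column_height :: "(nat \<times> nat) set \<Rightarrow> nat \<Rightarrow> nat" where
  "column_height F j = card {i. (i, j) \<in> F}"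

text \<open>The set written \<open>[c\<^sub>1, \<dots>, c\<^sub>n]\<close>.\<close>

definition ferrers_of_columns :: "nat list \<Rightarrow> (nat \<times> nat) set" where
  "ferrers_of_columns cs = {(i, j). 1 \<le> j \<and> j \<le> length cs \<and> 1 \<le> i \<and> i \<le> cs ! (j - 1)}"

lemma column_height_ferrers_of_columns:
  assumes "1 \<le> j" "j \<le> length cs"
  shows "column_height (ferrers_of_columns cs) j = cs ! (j - 1)"
proof -
  have "{i. (i, j) \<in> ferrers_of_columns cs} = {1..cs ! (j - 1)}"
    using assms by (auto simp: ferrers_of_columns_def)
  then show ?thesis by (simp add: column_height_def)
qed

text \<open>Truncated subtraction on natural numbers plays the role of \<open>max {c\<^sub>t - j, 0}\<close>.\<close>

definition ferrers_nu :: "nat \<Rightarrow> (nat \<times> nat) set \<Rightarrow> nat \<Rightarrow> nat \<Rightarrow> nat" where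
  "ferrers_nu n F \<delta> j = (\<Sum>t = 1..n - \<delta> + 1 + j. column_height F t - j)"

definition ferrers_nu_min :: "nat \<Rightarrow> (nat \<times> nat) set \<Rightarrow> nat \<Rightarrow> nat" where
  "ferrers_nu_min n F \<delta> = Min (ferrers_nu n F \<delta> ` {0..\<delta> - 1})"

section \<open>Rank-metric codes supported on a Ferrers diagram\<close>

text \<open>The vector space of \<open>m \<times> n\<close> matrices. Its multiplicative components are not used by
  the theory of modules, as in \<^const>\<open>module_vec\<close>.\<close>

definition mat_space :: "'a::field itself \<Rightarrow> nat \<Rightarrow> nat \<Rightarrow> ('a, 'a mat) module" where
  "mat_space ty m n = \<lparr>
     carrier = carrier_mat m n,
     monoid.mult = undefined,
     monoid.one = undefined,
     zero = 0\<^sub>m m n,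
     add = (+),
     smult = (\<cdot>\<^sub>m)\<rparr>"

lemma vectorspace_mat_space:
  "vectorspace class_ring (mat_space TYPE('a::field) m n)"
proof (rule vs_criteria)
  show "field (class_ring :: 'a ring)" by (rule class_field.field_axioms)
  show "\<forall>v\<in>carrier (mat_space TYPE('a) m n).
      \<exists>neg_v\<in>carrier (mat_space TYPE('a) m n).
        v \<oplus>\<^bsub>mat_space TYPE('a) m n\<^esub> neg_v = \<zero>\<^bsub>mat_space TYPE('a) m n\<^esub>"
  proof
    fix v assume "v \<in> carrier (mat_space TYPE('a) m n)"
    then show "\<exists>neg_v\<in>carrier (mat_space TYPE('a) m n).
        v \<oplus>\<^bsub>mat_space TYPE('a) m n\<^esub> neg_v = \<zero>\<^bsub>mat_space TYPE('a) m n\<^esub>"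
      by (intro bexI[of _ "- v"]) (auto simp: mat_space_def)
  qed
qed (auto simp: mat_space_def comm_add_mat assoc_add_mat[of _ m n] mult.assoc
      add_smult_distrib_right_mat add_smult_distrib_left_mat intro!: eq_matI)

definition has_rank_distance ::
    "nat \<Rightarrow> nat \<Rightarrow> ('a::field) mat set \<Rightarrow> nat \<Rightarrow> bool" where
  "has_rank_distance m n C \<delta> \<longleftrightarrow>
     (\<exists>A \<in> C - {0\<^sub>m m n}. vec_space.rank m A = \<delta>) \<and>
     (\<forall>A \<in> C - {0\<^sub>m m n}. \<delta> \<le> vec_space.rank m A)"

text \<open>Matrix entries are indexed from 0, hence the shift by \<^const>\<open>Suc\<close>.\<close>

definition ferrers_code ::
    "nat \<Rightarrow> nat \<Rightarrow> (nat \<times> nat) set \<Rightarrow> nat \<Rightarrow> ('a::field) mat set \<Rightarrow> bool" where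
  "ferrers_code m n F \<delta> C \<longleftrightarrow>
     ferrers_diagram m n F \<and>
     VectorSpace.subspace class_ring C (mat_space TYPE('a) m n) \<and>
     (\<forall>A \<in> C. \<forall>i < m. \<forall>j < n. A $$ (i, j) \<noteq> 0 \<longrightarrow> (Suc i, Suc j) \<in> F) \<and>
     has_rank_distance m n C \<delta>"

definition maximal_ferrers_code ::
    "nat \<Rightarrow> nat \<Rightarrow> (nat \<times> nat) set \<Rightarrow> nat \<Rightarrow> ('a::field) mat set \<Rightarrow> bool" where
  "maximal_ferrers_code m n F \<delta> C \<longleftrightarrow>
     ferrers_code m n F \<delta> C \<and>
     vectorspace.dim class_ring ((mat_space TYPE('a) m n)\<lparr>carrier := C\<rparr>) = ferrers_nu_min n F \<delta>"

end

theory Submission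
  imports Defs "HOL-Algebra.Algebraic_Closure_Type" "HOL-Number_Theory.Residues"
begin

text \<open>Let \<open>K\<close> be the field with \<open>q\<^sup>m\<close> elements, inside the algebraic closure of the given field
  with \<open>q\<close> elements. As for Gabidulin codes, a linearized polynomial with \<open>l\<close> coefficients in \<open>K\<close>
  yields an \<open>m \<times> n\<close> matrix by expanding its values at \<open>n\<close> independent points \<open>e\<^sub>1, \<dots>, e\<^sub>n\<close>
  in a basis \<open>\<omega>\<close> of \<open>K\<close>; such a polynomial has at most \<open>q^(l - 1)\<close> roots, so the matrix has rank at
  least \<open>n - l + 1 = \<delta>\<close>. The shape constrains only the values at \<open>e\<^sub>1, \<dots>, e\<^sub>l\<^sub>+\<^sub>1\<close>. A polynomial with \<open>l + 1\<close>
  coefficients is determined freely by these values, so everything hinges on how many values the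
  top coefficient can take. Let the span \<open>E\<close> of \<open>e\<^sub>1, \<dots>, e\<^sub>l\<^sub>+\<^sub>1\<close> and the span of the first
  \<open>l + 1 - b\<close> of them be spaces over the field \<open>GF b\<close> with \<open>q\<^sup>b\<close> elements. Precomposition
  with multiplications by elements of \<open>GF b\<close> shows that the top coefficients of the functionals on \<open>E\<close> form a
  \<open>GF b\<close>-space \<open>W\<close> with \<open>q^(l + 1)\<close> elements, and that those of the last \<open>b\<close> dual basis functionals lie on
  one line \<open>c GF b\<close>. Choosing \<open>\<omega>\<close> adapted to \<open>GF b \<subseteq> c\<inverse> W \<subseteq> K\<close>, all top coefficients lie in \<open>W\<close>,
  hence their vanishing costs at most \<open>l + 1\<close> dimensions. The resulting code has the dimension allowed by its
  first \<open>l\<close> columns, which determine a codeword; so every choice of these columns occurs, and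
  one with a single nonzero entry in column \<open>l\<close> gives rank exactly \<open>\<delta>\<close>.\<close>

section \<open>Counting a finite set through the fibres of a map\<close>

text \<open>Subtracting a fixed element of a fibre embeds that fibre in \<open>N\<close>. The
  operation \<open>d\<close> is left abstract so that one bound serves field elements, truncated
  coefficient functions and vectors; it takes the place of rank-nullity.\<close>

lemma card_le_image_times_fibre:
  assumes "finite G" "finite N"
    and diff: "\<And>x y. x \<in> G \<Longrightarrow> y \<in> G \<Longrightarrow> h x = h y \<Longrightarrow> d x y \<in> N"
    and inj: "\<And>y. y \<in> G \<Longrightarrow> inj_on (\<lambda>x. d x y) {x \<in> G. h x = h y}"
  shows "card G \<le> card (h ` G) * card N"
proof -
  have fib: "card {x \<in> G. h x = w} \<le> card N" if w: "w \<in> h ` G" for w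
  proof -
    obtain y where y: "y \<in> G" "w = h y" using w by auto
    show ?thesis
    proof (rule card_inj_on_le[OF _ _ \<open>finite N\<close>])
      show "inj_on (\<lambda>x. d x y) {x \<in> G. h x = w}"
        using inj[OF y(1)] y(2) by simp
      show "(\<lambda>x. d x y) ` {x \<in> G. h x = w} \<subseteq> N"
        using diff y by auto
    qed
  qed
  have "card G = (\<Sum>w\<in>h ` G. card {x \<in> G. h x = w})"
    using sum.image_gen[OF \<open>finite G\<close>, of "\<lambda>_. 1::nat" h] by simp
  also have "\<dots> \<le> (\<Sum>w\<in>h ` G. card N)"
    using fib by (intro sum_mono)
  finally show ?thesis by simp
qed

section \<open>The subfields of the algebraic closure of a finite field\<close>

text \<open>The characteristic is a prime dividing \<open>CARD('a)\<close>, which is a power of a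
  prime \<open>r\<close>; hence it equals \<open>r\<close>. This makes \<open>q\<close>-th powers
  additive.\<close>

lemma card_field_eq_CHAR_power:
  assumes "primepow CARD('a::{field,finite})"
  shows "normalization_semidom_class.prime CHAR('a)" "\<exists>n. CARD('a) = CHAR('a) ^ n"
proof -
  have "CHAR('a) > 0"
    by (rule finite_imp_CHAR_pos) simp
  then show p: "normalization_semidom_class.prime CHAR('a)"
    by (rule prime_CHAR_semidom)
  obtain r n where r: "normalization_semidom_class.prime r" "CARD('a) = r ^ n"
    using assms by (auto simp: primepow_def)
  have "CHAR('a) dvd r ^ n"
    using CHAR_dvd_CARD[where 'a='a] r by simp
  then have "CHAR('a) dvd r"
    using p prime_dvd_power by blast
  then have "CHAR('a) = r"
    using p r by (simp add: primes_dvd_imp_eq)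
  then show "\<exists>n. CARD('a) = CHAR('a) ^ n"
    using r by blast
qed

lemma CARD_field_gt_1: "CARD('a::{field,finite}) > 1"
proof -
  have "card {0, 1::'a} \<le> CARD('a)"
    by (intro card_mono) auto
  then show ?thesis by simp
qed

text \<open>Multiplication by a nonzero \<open>a\<close> permutes the nonzero elements; comparing
  their products gives \<open>a ^ (CARD('a) - 1) = 1\<close>.\<close>

lemma finite_field_power_CARD:
  fixes a :: "'a::{field,finite}"
  shows "a ^ CARD('a) = a"
proof (cases "a = 0")
  case True
  then show ?thesis
    using CARD_field_gt_1[where 'a='a] by (simp add: power_0_left)
next
  case False
  have "bij_betw ((*) a) (UNIV - {0}) (UNIV - {0})"
    by (rule bij_betwI[of _ _ _ "(*) (inverse a)"]) (use False in auto)
  then have "(\<Prod>x\<in>UNIV - {0}. a * x) = \<Prod>(UNIV - {0::'a})"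
    by (rule prod.reindex_bij_betw)
  then have "a ^ (CARD('a) - 1) * \<Prod>(UNIV - {0::'a}) = 1 * \<Prod>(UNIV - {0::'a})"
    by (simp add: prod.distrib card_Diff_singleton)
  then have "a ^ (CARD('a) - 1) = 1"
    by (subst (asm) mult_cancel_right) simp
  then have "a * a ^ (CARD('a) - 1) = a" by simp
  then show ?thesis
    by (metis Suc_diff_1 power_Suc zero_less_card_finite)
qed

text \<open>For \<open>d = 0\<close> this is the whole algebraic closure.\<close>

definition GF :: "nat \<Rightarrow> 'a::{field,finite} alg_closure set" where
  "GF d = {x. x ^ (CARD('a) ^ d) = x}"

locale prime_power_field =
  fixes ty :: "'a::{field,finite} itself"
  assumes primepow: "primepow CARD('a)"
begin

lemma frobenius_add:
  fixes x y :: "'a alg_closure"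
  shows "(x + y) ^ (CARD('a) ^ d) = x ^ (CARD('a) ^ d) + y ^ (CARD('a) ^ d)"
proof -
  obtain n where "CARD('a) = CHAR('a) ^ n"
    using card_field_eq_CHAR_power[OF primepow] by blast
  then show ?thesis
    using card_field_eq_CHAR_power[OF primepow]
    by (intro freshmans_dream'[of _ "n * d"]) (simp_all add: power_mult)
qed

lemma frobenius_minus:
  fixes x :: "'a alg_closure"
  shows "(- x) ^ (CARD('a) ^ d) = - (x ^ (CARD('a) ^ d))"
proof -
  have "(- x) ^ (CARD('a) ^ d) + x ^ (CARD('a) ^ d) = 0"
    using frobenius_add[of "- x" x d] by (simp add: power_0_left)
  then show ?thesis by (simp add: eq_neg_iff_add_eq_0)
qed

lemma frobenius_sum:
  fixes f :: "'i \<Rightarrow> 'a alg_closure"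
  shows "(\<Sum>i\<in>A. f i) ^ (CARD('a) ^ d) = (\<Sum>i\<in>A. f i ^ (CARD('a) ^ d))"
  by (induction A rule: infinite_finite_induct) (auto simp: frobenius_add power_0_left)

lemma frobenius_inj:
  fixes x y :: "'a alg_closure"
  assumes "x ^ (CARD('a) ^ d) = y ^ (CARD('a) ^ d)"
  shows "x = y"
proof -
  have "(x - y) ^ (CARD('a) ^ d) = 0"
    using frobenius_add[of x "- y" d] assms by (simp add: frobenius_minus)
  then show ?thesis by simp
qed

lemma GF_iff: "x \<in> GF d \<longleftrightarrow> x ^ (CARD('a) ^ d) = (x :: 'a alg_closure)"
  by (simp add: GF_def)

lemma to_ac_frobenius: "to_ac (a :: 'a) ^ (CARD('a) ^ d) = to_ac a"
proof -
  have "a ^ (CARD('a) ^ d) = a"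
    by (induction d) (simp_all add: power_mult finite_field_power_CARD)
  then show ?thesis by (metis to_ac_power)
qed

lemma to_ac_in_GF: "to_ac (a :: 'a) \<in> GF d"
  by (simp add: GF_iff to_ac_frobenius)

lemma GF_add: "x \<in> GF d \<Longrightarrow> y \<in> GF d \<Longrightarrow> x + y \<in> (GF d :: 'a alg_closure set)"
  by (simp add: GF_iff frobenius_add)

lemma GF_mult: "x \<in> GF d \<Longrightarrow> y \<in> GF d \<Longrightarrow> x * y \<in> (GF d :: 'a alg_closure set)"
  by (simp add: GF_iff power_mult_distrib)

lemma GF_uminus: "x \<in> GF d \<Longrightarrow> - x \<in> (GF d :: 'a alg_closure set)"
  by (simp add: GF_iff frobenius_minus)

lemma GF_diff: "x \<in> GF d \<Longrightarrow> y \<in> GF d \<Longrightarrow> x - y \<in> (GF d :: 'a alg_closure set)"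
  using GF_add[of x d "- y"] GF_uminus[of y d] by simp

lemma GF_inverse: "x \<in> GF d \<Longrightarrow> inverse x \<in> (GF d :: 'a alg_closure set)"
  by (simp add: GF_iff power_inverse)

lemma GF_0: "0 \<in> (GF d :: 'a alg_closure set)"
  by (simp add: GF_iff power_0_left)

lemma GF_1: "1 \<in> (GF d :: 'a alg_closure set)"
  by (simp add: GF_iff)

lemma GF_sum: "(\<And>i. i \<in> A \<Longrightarrow> f i \<in> GF d) \<Longrightarrow> (\<Sum>i\<in>A. f i) \<in> (GF d :: 'a alg_closure set)"
  by (induction A rule: infinite_finite_induct) (auto simp: GF_0 GF_add)

lemma GF_power: "x \<in> GF d \<Longrightarrow> x ^ k \<in> (GF d :: 'a alg_closure set)"
  by (induction k) (auto simp: GF_1 GF_mult)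

lemma GF_mono:
  assumes "b dvd d"
  shows "GF b \<subseteq> (GF d :: 'a alg_closure set)"
proof
  fix x :: "'a alg_closure" assume x: "x \<in> GF b"
  obtain k where k: "d = b * k" using assms by blast
  have "x ^ (CARD('a) ^ (b * k)) = x"
    using x by (induction k) (simp_all add: power_add power_mult GF_iff)
  then show "x \<in> GF d" by (simp add: k GF_iff)
qed

text \<open>\<open>GF d\<close> is the root set of \<open>x ^ (q ^ d) - x\<close>. This polynomial
  splits over the algebraic closure, and its derivative is the constant \<open>- 1\<close>, so no
  root is repeated and the number of roots is the degree.\<close>

lemma card_GF:
  assumes "d > 0"
  shows "card (GF d :: 'a alg_closure set) = CARD('a) ^ d"
proof -
  let ?q = "CARD('a) ^ d"
  define p :: "'a alg_closure poly" where "p = Polynomial.monom 1 ?q - Polynomial.monom 1 1"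
  have q1: "?q > 1"
    using CARD_field_gt_1[where 'a='a] assms by (intro one_less_power)
  have deg: "Polynomial.degree p = ?q"
    unfolding p_def using q1
    by (simp only: diff_conv_add_uminus, subst degree_add_eq_left) (auto simp: degree_monom_eq)
  have lead: "Polynomial.lead_coeff p = 1"
    using q1 unfolding deg by (simp add: p_def)
  have p0: "p \<noteq> 0" using lead by auto
  have "of_nat ?q = (0 :: 'a alg_closure)"
    using CHAR_dvd_CARD[where 'a='a] assms
    by (subst of_nat_eq_0_iff_char_dvd) (simp add: dvd_power_le dvd_trans[OF _ dvd_power])
  then have pd: "pderiv p = - 1"
    using assms by (auto simp: p_def pderiv_diff pderiv_monom monom_0 one_pCons power_0_left)
  obtain A where A: "size A = Polynomial.degree p"
      "p = Polynomial.smult (Polynomial.lead_coeff p) (\<Prod>x\<in>#A. [:- x, 1:])"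
    using alg_closed_imp_factorization[OF p0] by metis
  have mult1: "count A x \<le> 1" for x
  proof (rule ccontr)
    assume "\<not> count A x \<le> 1"
    then have "count A x \<ge> 2" by simp
    then have "{#x, x#} \<subseteq># A"
      by (auto simp: subseteq_mset_def numeral_2_eq_2)
    then obtain B where "A = {#x, x#} + B"
      by (auto simp: mset_subset_eq_exists_conv)
    then have "p = [:- x, 1:] * ([:- x, 1:] * (\<Prod>x\<in>#B. [:- x, 1:]))"
      using A(2) lead by simp
    then have "poly (pderiv p) x = 0"
      by (simp only: pderiv_mult poly_add poly_mult) simp
    then show False by (simp add: pd)
  qed
  have "A = mset_set (set_mset A)"
  proof (rule multiset_eqI)
    fix x
    show "count A x = count (mset_set (set_mset A)) x"
    proof (cases "x \<in># A")
      case True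
      then have "count A x = 1"
        using mult1[of x] count_greater_zero_iff[of A x] by linarith
      then show ?thesis using True by simp
    next
      case False
      then show ?thesis by (simp add: not_in_iff)
    qed
  qed
  then have "card (set_mset A) = ?q"
    using A(1) deg size_mset_set[of "set_mset A"] by argo
  moreover have "set_mset A = GF d"
  proof -
    have "poly p x = (\<Prod>a\<in>#A. x - a)" for x
      using A(2) lead by (simp add: poly_prod_mset)
    then have "poly p x = 0 \<longleftrightarrow> x \<in># A" for x
      by (auto simp: prod_mset_zero_iff)
    moreover have "poly p x = 0 \<longleftrightarrow> x \<in> GF d" for x
      by (simp add: p_def poly_monom GF_iff)
    ultimately show ?thesis by blast
  qed
  ultimately show ?thesis by simp
qed

lemma finite_GF: "d > 0 \<Longrightarrow> finite (GF d :: 'a alg_closure set)"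
  by (rule card_ge_0_finite) (simp add: card_GF)

end

section \<open>Linearized polynomials and bases\<close>

definition qpoly :: "nat \<Rightarrow> (nat \<Rightarrow> 'a::{field,finite} alg_closure) \<Rightarrow> 'a alg_closure \<Rightarrow> 'a alg_closure"
  where "qpoly k f x = (\<Sum>j<k. f j * x ^ (CARD('a) ^ j))"

definition comb :: "nat \<Rightarrow> (nat \<Rightarrow> 'a::{field,finite} alg_closure) \<Rightarrow> (nat \<Rightarrow> 'a) \<Rightarrow> 'a alg_closure"
  where "comb k e v = (\<Sum>i<k. to_ac (v i) * e i)"

text \<open>Stated as one bijection from coordinate tuples, which packs independence, spanning and
  the cardinality of \<open>S\<close> together. Tuples are extensional so that coordinates are
  unique as functions.\<close>

definition fq_basis :: "nat \<Rightarrow> (nat \<Rightarrow> 'a::{field,finite} alg_closure) \<Rightarrow> 'a alg_closure set \<Rightarrow> bool"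
  where "fq_basis k e S \<longleftrightarrow> bij_betw (comb k e) ({..<k} \<rightarrow>\<^sub>E UNIV) S"

text \<open>For \<open>Q = GF b\<close> or \<open>Q = range to_ac\<close> these are the subspaces
  over that field; negation comes from \<open>- 1\<close> in \<open>Q\<close>.\<close>

definition stable_subgroup :: "'b::comm_ring set \<Rightarrow> 'b set \<Rightarrow> bool"
  where "stable_subgroup Q S \<longleftrightarrow>
    0 \<in> S \<and> (\<forall>x\<in>S. \<forall>y\<in>S. x + y \<in> S) \<and> (\<forall>a\<in>Q. \<forall>x\<in>S. a * x \<in> S)"

lemma stable_subgroupD:
  assumes "stable_subgroup Q S"
  shows "0 \<in> S" "x \<in> S \<Longrightarrow> y \<in> S \<Longrightarrow> x + y \<in> S" "a \<in> Q \<Longrightarrow> x \<in> S \<Longrightarrow> a * x \<in> S"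
  using assms by (auto simp: stable_subgroup_def)

lemma stable_subgroup_sum:
  assumes "stable_subgroup Q S" "\<And>i. i \<in> A \<Longrightarrow> f i \<in> S"
  shows "sum f A \<in> S"
  using assms(2) by (induction A rule: infinite_finite_induct) (auto intro: stable_subgroupD[OF assms(1)])

lemma qpoly_cong: "(\<And>j. j < k \<Longrightarrow> f j = g j) \<Longrightarrow> qpoly k f x = qpoly k g x"
  by (simp add: qpoly_def)

lemma comb_cong: "(\<And>i. i < k \<Longrightarrow> e i = e' i) \<Longrightarrow> (\<And>i. i < k \<Longrightarrow> v i = w i) \<Longrightarrow> comb k e v = comb k e' w"
  by (simp add: comb_def)

lemma comb_add: "comb k e (\<lambda>i. v i + w i) = comb k e v + comb k e w"
  by (simp add: comb_def sum.distrib distrib_right)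

lemma comb_diff: "comb k e (\<lambda>i. v i - w i) = comb k e v - comb k e w"
  by (simp add: comb_def sum_subtractf left_diff_distrib)

lemma comb_scale: "comb k e (\<lambda>i. a * v i) = to_ac a * comb k e v"
  by (simp add: comb_def sum_distrib_left mult.assoc)

lemma comb_Suc: "comb (Suc k) e v = comb k e v + to_ac (v k) * e k"
  by (simp add: comb_def)

lemma comb_extend_zero:
  "n \<le> m \<Longrightarrow> comb n e v = comb m e (\<lambda>i. if i < n then v i else 0)"
  unfolding comb_def by (rule sum.mono_neutral_cong_left) auto

lemma comb_unit: "i < k \<Longrightarrow> comb k e (\<lambda>j. if j = i then 1 else 0) = e i"
  by (simp add: comb_def if_distrib[of to_ac] if_distrib[of "\<lambda>x. x * _"] cong: if_cong)

lemma qpoly_add: "qpoly k (\<lambda>j. f j + g j) x = qpoly k f x + qpoly k g x"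
  by (simp add: qpoly_def sum.distrib distrib_right)

lemma qpoly_diff: "qpoly k (\<lambda>j. f j - g j) x = qpoly k f x - qpoly k g x"
  by (simp add: qpoly_def sum_subtractf left_diff_distrib)

lemma qpoly_scale: "qpoly k (\<lambda>j. c * f j) x = c * qpoly k f x"
  by (simp add: qpoly_def sum_distrib_left mult.assoc)

lemma qpoly_sum: "qpoly k (\<lambda>j. \<Sum>i\<in>A. f i j) x = (\<Sum>i\<in>A. qpoly k (f i) x)"
proof -
  have "qpoly k (\<lambda>j. \<Sum>i\<in>A. f i j) x = (\<Sum>j<k. \<Sum>i\<in>A. f i j * x ^ (CARD('a) ^ j))"
    by (simp add: qpoly_def sum_distrib_right)
  also have "\<dots> = (\<Sum>i\<in>A. qpoly k (f i) x)"
    unfolding qpoly_def by (rule sum.swap)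
  finally show ?thesis .
qed

lemma qpoly_Suc: "qpoly (Suc k) f x = qpoly k f x + f k * x ^ (CARD('a) ^ k)"
  for x :: "'a::{field,finite} alg_closure"
  by (simp add: qpoly_def)

text \<open>Precomposition with a multiplication keeps a linearized polynomial linearized and of the
  same length; \<open>twist\<close> rests on this.\<close>

lemma qpoly_mult_arg:
  "qpoly k (\<lambda>j. f j * a ^ (CARD('a) ^ j)) x = qpoly k f (a * x)" for x :: "'a::{field,finite} alg_closure"
  by (simp add: qpoly_def power_mult_distrib mult.assoc)

lemma fq_basis_comb_in:
  assumes "fq_basis k e S"
  shows "comb k e v \<in> S"
proof -
  have "comb k e v = comb k e (restrict v {..<k})"
    by (rule comb_cong) auto
  then show ?thesis
    using assms by (auto simp: fq_basis_def bij_betw_def)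
qed

lemma fq_basis_coords:
  assumes "fq_basis k e S" "x \<in> S"
  obtains v where "x = comb k e v"
  using assms by (auto simp: fq_basis_def bij_betw_def)

lemma fq_basis_inj:
  assumes "fq_basis k e S" "comb k e v = comb k e w" "i < k"
  shows "v i = w i"
proof -
  have "comb k e (restrict v {..<k}) = comb k e (restrict w {..<k})"
    using assms(2) comb_cong[of k e e v "restrict v {..<k}"] comb_cong[of k e e w "restrict w {..<k}"] by auto
  then have "restrict v {..<k} = restrict w {..<k}"
    using assms(1) by (auto simp: fq_basis_def bij_betw_def inj_on_def)
  then show ?thesis
    using assms(3) by (metis lessThan_iff restrict_apply')
qed

lemma fq_basis_independent:
  assumes "fq_basis k e S" "comb k e v = 0" "i < k"
  shows "v i = 0"
proof -
  have "comb k e v = comb k e (\<lambda>_. 0)"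
    by (simp only: assms(2)) (simp add: comb_def)
  from fq_basis_inj[OF assms(1) this assms(3)] show ?thesis .
qed

lemma fq_basis_segment_independent:
  assumes "fq_basis m e S" "n \<le> m" "comb n e v = 0" "i < n"
  shows "v i = 0"
proof -
  have "comb m e (\<lambda>i. if i < n then v i else 0) = 0"
    using comb_extend_zero[OF assms(2)] assms(3) by metis
  from fq_basis_independent[OF assms(1) this, of i] show ?thesis
    using assms(2,4) by auto
qed

lemma fq_basisI:
  assumes "\<And>v. comb k e v = 0 \<Longrightarrow> \<forall>i<k. v i = 0"
    and "\<And>v. comb k e v \<in> S"
    and "\<And>x. x \<in> S \<Longrightarrow> \<exists>v. x = comb k e v"
  shows "fq_basis k e S"
  unfolding fq_basis_def bij_betw_def
proof
  show "inj_on (comb k e) ({..<k} \<rightarrow>\<^sub>E UNIV)"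
  proof (rule inj_onI)
    fix v w assume v: "v \<in> {..<k} \<rightarrow>\<^sub>E UNIV" and w: "w \<in> {..<k} \<rightarrow>\<^sub>E UNIV"
      and eq: "comb k e v = comb k e w"
    have "comb k e (\<lambda>i. v i - w i) = 0"
      by (simp only: comb_diff eq diff_self)
    from assms(1)[OF this] show "v = w"
      by (intro PiE_ext[OF v w]) simp
  qed
  show "comb k e ` ({..<k} \<rightarrow>\<^sub>E UNIV) = S"
  proof
    show "S \<subseteq> comb k e ` ({..<k} \<rightarrow>\<^sub>E UNIV)"
    proof
      fix x assume "x \<in> S"
      then obtain v where "x = comb k e v" using assms(3) by metis
      also have "comb k e v = comb k e (restrict v {..<k})"
        by (rule comb_cong) simp_all
      finally have x: "x = comb k e (restrict v {..<k})" .
      show "x \<in> comb k e ` ({..<k} \<rightarrow>\<^sub>E UNIV)"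
        unfolding x by (rule imageI) (simp add: PiE_iff extensional_def)
    qed
    show "comb k e ` ({..<k} \<rightarrow>\<^sub>E UNIV) \<subseteq> S"
      by (rule image_subsetI) (rule assms(2))
  qed
qed

lemma card_fq_basis:
  fixes e :: "nat \<Rightarrow> 'a::{field,finite} alg_closure"
  assumes "fq_basis k e S"
  shows "card S = CARD('a) ^ k"
proof -
  have "card S = card ({..<k} \<rightarrow>\<^sub>E (UNIV :: 'a set))"
    using assms unfolding fq_basis_def by (metis bij_betw_same_card)
  then show ?thesis by (simp add: card_PiE)
qed

lemma finite_fq_basis:
  fixes e :: "nat \<Rightarrow> 'a::{field,finite} alg_closure"
  assumes "fq_basis k e S"
  shows "finite S"
  by (rule card_ge_0_finite) (simp add: card_fq_basis[OF assms])

lemma fq_basis_mem: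
  assumes "fq_basis k e S" "i < k"
  shows "e i \<in> S"
  using fq_basis_comb_in[OF assms(1)] comb_unit[OF assms(2)] by metis

lemma fq_basis_cong:
  assumes "\<And>i. i < k \<Longrightarrow> e i = e' i"
  shows "fq_basis k e S \<longleftrightarrow> fq_basis k e' S"
proof -
  have "comb k e = comb k e'"
    using assms by (auto simp: comb_def)
  then show ?thesis by (simp add: fq_basis_def)
qed

lemma fq_basis_0: "fq_basis 0 e {0}"
  by (rule fq_basisI) (auto simp: comb_def)

text \<open>In a linear relation a nonzero coefficient of \<open>y\<close> could be inverted, which
  would express \<open>y\<close> through \<open>S\<close>.\<close>

lemma fq_basis_insert:
  fixes e :: "nat \<Rightarrow> 'a::{field,finite} alg_closure"
  assumes b: "fq_basis k e S" and "stable_subgroup (range to_ac) S" and y: "y \<notin> S"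
  shows "fq_basis (Suc k) (e(k := y)) {x + to_ac a * y |x a. x \<in> S}"
proof (rule fq_basisI)
  have c: "comb (Suc k) (e(k := y)) v = comb k e v + to_ac (v k) * y" for v
    using comb_cong[of k "e(k := y)" e v v] by (simp add: comb_Suc)
  show "\<forall>i<Suc k. v i = 0" if z: "comb (Suc k) (e(k := y)) v = 0" for v
  proof -
    have "v k = 0"
    proof (rule ccontr)
      assume vk: "v k \<noteq> 0"
      have "comb k e v + to_ac (v k) * y = 0" using z by (simp only: c)
      then have eq: "to_ac (v k) * y = - comb k e v"
        by (simp only: eq_neg_iff_add_eq_0 add.commute)
      have "to_ac (inverse (v k)) * to_ac (v k) = 1" using vk by simp
      then have "to_ac (inverse (v k)) * (to_ac (v k) * y) = y"
        by (simp only: mult.assoc[symmetric] mult_1_left)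
      then have "y = to_ac (- inverse (v k)) * comb k e v"
        by (simp only: eq to_ac_minus mult_minus_left mult_minus_right)
      moreover have "to_ac (- inverse (v k)) * comb k e v \<in> S"
        by (intro stable_subgroupD(3)[OF assms(2)] fq_basis_comb_in[OF b] rangeI)
      ultimately show False using y by metis
    qed
    moreover have "comb k e v = 0" using z \<open>v k = 0\<close> by (simp add: c)
    ultimately show ?thesis
      using fq_basis_independent[OF b, of v] by (auto simp: less_Suc_eq)
  qed
  show "comb (Suc k) (e(k := y)) v \<in> {x + to_ac a * y |x a. x \<in> S}" for v
    unfolding c using fq_basis_comb_in[OF b, of v] by blast
  show "\<exists>v. z = comb (Suc k) (e(k := y)) v" if "z \<in> {x + to_ac a * y |x a. x \<in> S}" for z
  proof -
    obtain x a where x: "x \<in> S" "z = x + to_ac a * y" using \<open>z \<in> _\<close> by blast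
    obtain v where v: "x = comb k e v" using fq_basis_coords[OF b x(1)] by blast
    have "comb k e v = comb k e (v(k := a))" by (rule comb_cong) auto
    then have "z = comb (Suc k) (e(k := y)) (v(k := a))"
      unfolding c x(2) v by simp
    then show ?thesis by blast
  qed
qed

lemma stable_subgroup_adjoin:
  assumes "stable_subgroup Q S" "0 \<in> Q"
    and "\<And>a b. a \<in> Q \<Longrightarrow> b \<in> Q \<Longrightarrow> a + b \<in> Q" "\<And>a b. a \<in> Q \<Longrightarrow> b \<in> Q \<Longrightarrow> a * b \<in> Q"
  shows "stable_subgroup Q {x + a * y |x a. x \<in> S \<and> a \<in> Q}"
  unfolding stable_subgroup_def
proof (intro conjI ballI)
  have "0 = 0 + 0 * y \<and> 0 \<in> S \<and> 0 \<in> Q"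
    using stable_subgroupD(1)[OF assms(1)] assms(2) by simp
  then show "0 \<in> {x + a * y |x a. x \<in> S \<and> a \<in> Q}" by blast
next
  fix u v assume "u \<in> {x + a * y |x a. x \<in> S \<and> a \<in> Q}" "v \<in> {x + a * y |x a. x \<in> S \<and> a \<in> Q}"
  then obtain x a x' a' where "u = x + a * y" "v = x' + a' * y" "x \<in> S" "x' \<in> S" "a \<in> Q" "a' \<in> Q"
    by blast
  then have "u + v = (x + x') + (a + a') * y" "x + x' \<in> S" "a + a' \<in> Q"
    using stable_subgroupD[OF assms(1)] assms(3) by (auto simp: algebra_simps)
  then show "u + v \<in> {x + a * y |x a. x \<in> S \<and> a \<in> Q}" by blast
next
  fix c u assume "c \<in> Q" "u \<in> {x + a * y |x a. x \<in> S \<and> a \<in> Q}"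
  then obtain x a where "u = x + a * y" "x \<in> S" "a \<in> Q" by blast
  then have "c * u = c * x + (c * a) * y" "c * x \<in> S" "c * a \<in> Q"
    using stable_subgroupD[OF assms(1)] assms(4) \<open>c \<in> Q\<close> by (auto simp: algebra_simps)
  then show "c * u \<in> {x + a * y |x a. x \<in> S \<and> a \<in> Q}" by blast
qed

lemma range_to_ac_0: "0 \<in> range to_ac"
  using rangeI[of to_ac 0] by simp

lemma range_to_ac_closed:
  assumes "a \<in> range to_ac" "b \<in> range to_ac"
  shows "a + b \<in> range to_ac" "a * b \<in> range to_ac"
proof -
  obtain x y where "a = to_ac x" "b = to_ac y" using assms by blast
  then show "a + b \<in> range to_ac" "a * b \<in> range to_ac"
    using rangeI[of to_ac "x + y"] rangeI[of to_ac "x * y"] by simp_all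
qed

lemma stable_subgroup_zero: "stable_subgroup Q {0}"
  by (simp add: stable_subgroup_def)

lemma stable_subgroup_range_to_ac: "stable_subgroup (range to_ac) (range to_ac)"
  using range_to_ac_0 range_to_ac_closed unfolding stable_subgroup_def by blast

lemma fq_basis_adjoin:
  fixes e :: "nat \<Rightarrow> 'a::{field,finite} alg_closure"
  assumes "fq_basis k e S" "stable_subgroup (range to_ac) S"
    and Y: "stable_subgroup (range to_ac) Y" and "S \<subseteq> Y" "y \<in> Y" "y \<notin> S"
  obtains S' where "fq_basis (Suc k) (e(k := y)) S'" "stable_subgroup (range to_ac) S'" "S' \<subseteq> Y"
proof
  let ?S = "{x + to_ac a * y |x a. x \<in> S}"
  show "fq_basis (Suc k) (e(k := y)) ?S"
    by (rule fq_basis_insert[OF assms(1,2) \<open>y \<notin> S\<close>])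
  have eq: "?S = {x + a * y |x a. x \<in> S \<and> a \<in> range to_ac}" by blast
  show "stable_subgroup (range to_ac) ?S"
    unfolding eq by (rule stable_subgroup_adjoin[OF assms(2) range_to_ac_0 range_to_ac_closed])
  show "?S \<subseteq> Y"
  proof clarify
    fix x a assume "x \<in> S"
    with \<open>S \<subseteq> Y\<close> have "x \<in> Y" by (rule subsetD)
    then show "x + to_ac a * y \<in> Y"
      by (intro stable_subgroupD(2,3)[OF Y] rangeI \<open>y \<in> Y\<close>)
  qed
qed

text \<open>Basis extension governed by cardinalities: as long as \<open>S\<close> is smaller than
  \<open>Y\<close> some \<open>y\<close> outside \<open>S\<close> can be adjoined, and after
  \<open>d\<close> steps equal cardinality forces \<open>S = Y\<close>.\<close>

lemma fq_basis_extend: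
  fixes e :: "nat \<Rightarrow> 'a::{field,finite} alg_closure"
  assumes "fq_basis k e S" "stable_subgroup (range to_ac) S"
    and Y: "stable_subgroup (range to_ac) Y" and "S \<subseteq> Y" "card Y = CARD('a) ^ (k + d)"
  obtains e' where "\<forall>i<k. e' i = e i" "fq_basis (k + d) e' Y"
  using assms(1,2,4,5)
proof (induction d arbitrary: k e S thesis)
  case 0
  have "finite Y" by (rule card_ge_0_finite) (simp add: 0)
  then have "S = Y"
    using 0 card_fq_basis[OF 0(2)] by (intro card_subset_eq) simp_all
  then show ?case using 0(1)[of e] 0(2) by simp
next
  case (Suc d)
  have "CARD('a) ^ k < CARD('a) ^ (k + Suc d)"
    using CARD_field_gt_1[where 'a='a] by (intro power_strict_increasing) simp_all
  then have "S \<noteq> Y"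
    using card_fq_basis[OF Suc.prems(2)] Suc.prems(5) by auto
  then obtain y where y: "y \<in> Y" "y \<notin> S" using Suc.prems(4) by blast
  obtain S' where S': "fq_basis (Suc k) (e(k := y)) S'" "stable_subgroup (range to_ac) S'" "S' \<subseteq> Y"
    using fq_basis_adjoin[OF Suc.prems(2,3) Y Suc.prems(4) y] .
  show ?case
  proof (rule Suc.IH[OF _ S'])
    show "card Y = CARD('a) ^ (Suc k + d)" using Suc.prems(5) by simp
    fix e' assume *: "\<forall>i<Suc k. e' i = (e(k := y)) i" "fq_basis (Suc k + d) e' Y"
    show thesis
    proof (rule Suc.prems(1))
      show "fq_basis (k + Suc d) e' Y" using *(2) by simp
      show "\<forall>i<k. e' i = e i" using *(1) by simp
    qed
  qed
qed

context prime_power_field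
begin

lemma stable_subgroup_GF:
  assumes "b dvd d"
  shows "stable_subgroup (GF b) (GF d :: 'a alg_closure set)"
  using GF_mono[OF assms] by (auto simp: stable_subgroup_def GF_0 GF_add GF_mult)

lemma stable_subgroup_to_ac:
  "stable_subgroup (GF b) S \<Longrightarrow> stable_subgroup (range to_ac) (S :: 'a alg_closure set)"
  by (auto simp: stable_subgroup_def to_ac_in_GF)

text \<open>Base field elements are fixed by every Frobenius power, so linearized polynomials are
  linear over the base field.\<close>

lemma qpoly_comb:
  "qpoly k f (comb n e v) = (\<Sum>i<n. to_ac (v i) * qpoly k f (e i :: 'a alg_closure))"
proof -
  have "comb n e v ^ (CARD('a) ^ j) = (\<Sum>i<n. to_ac (v i) * e i ^ (CARD('a) ^ j))" for j
    by (simp add: comb_def frobenius_sum power_mult_distrib to_ac_frobenius)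
  then have "qpoly k f (comb n e v) = (\<Sum>j<k. \<Sum>i<n. to_ac (v i) * (f j * e i ^ (CARD('a) ^ j)))"
    by (simp add: qpoly_def sum_distrib_left algebra_simps)
  also have "\<dots> = (\<Sum>i<n. \<Sum>j<k. to_ac (v i) * (f j * e i ^ (CARD('a) ^ j)))"
    by (rule sum.swap)
  finally show ?thesis by (simp add: qpoly_def sum_distrib_left)
qed

lemma qpoly_in_GF:
  assumes "\<And>j. j < k \<Longrightarrow> f j \<in> GF m" "x \<in> (GF m :: 'a alg_closure set)"
  shows "qpoly k f x \<in> GF m"
  unfolding qpoly_def using assms by (auto intro!: GF_sum GF_mult GF_power)

text \<open>As an ordinary polynomial this has degree at most \<open>q ^ (k - 1)\<close>, so more
  roots than that force it to vanish. The exponents \<open>q ^ j\<close> are distinct, hence each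
  \<open>f j\<close> is a coefficient of it.\<close>

lemma qpoly_coeffs_eq_0:
  fixes f :: "nat \<Rightarrow> 'a alg_closure"
  assumes "\<And>x. x \<in> S \<Longrightarrow> qpoly k f x = 0" and "card S > CARD('a) ^ (k - 1)" and "j < k"
  shows "f j = 0"
proof (rule ccontr)
  assume fj: "f j \<noteq> 0"
  define p where "p = (\<Sum>j<k. Polynomial.monom (f j) (CARD('a) ^ j))"
  have "Polynomial.coeff p (CARD('a) ^ j) = (\<Sum>i<k. if i = j then f i else 0)"
    using CARD_field_gt_1[where 'a='a]
    by (auto simp: p_def Polynomial.coeff_sum power_inject_exp intro!: sum.cong)
  then have "Polynomial.coeff p (CARD('a) ^ j) = f j"
    using \<open>j < k\<close> by simp
  then have p0: "p \<noteq> 0" using fj by auto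
  have "Polynomial.degree (Polynomial.monom (f j) (CARD('a) ^ j)) \<le> CARD('a) ^ (k - 1)"
    if "j < k" for j
  proof -
    have "CARD('a) ^ j \<le> CARD('a) ^ (k - 1)"
      using that by (intro power_increasing) (auto simp: Suc_le_eq)
    then show ?thesis using degree_monom_le[of "f j" "CARD('a) ^ j"] by linarith
  qed
  then have deg: "Polynomial.degree p \<le> CARD('a) ^ (k - 1)"
    unfolding p_def by (intro degree_sum_le) auto
  have "S \<subseteq> {x. poly p x = 0}"
    using assms(1) by (auto simp: p_def poly_sum poly_monom qpoly_def)
  then have "card S \<le> card {x. poly p x = 0}"
    using poly_roots_finite[OF p0] card_mono by blast
  also have "\<dots> \<le> Polynomial.degree p"
    by (rule card_poly_roots_bound[OF p0])
  finally show False using deg assms(2) by simp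
qed

text \<open>Adds one dimension over \<open>GF b\<close>: since \<open>k < m\<close> there is a
  \<open>y\<close> in \<open>GF m\<close> outside \<open>S\<close>, and the line through
  \<open>y\<close> is added to \<open>S\<close>.\<close>

lemma stable_subgroup_chain:
  assumes "b > 0" "b dvd m" "m > 0"
    and S: "stable_subgroup (GF b) S" "S \<subseteq> GF m" "card S = CARD('a) ^ k" "k < m"
  shows "\<exists>Y. S \<subseteq> Y \<and> Y \<subseteq> (GF m :: 'a alg_closure set) \<and> stable_subgroup (GF b) Y \<and> card Y = CARD('a) ^ (k + b)"
proof -
  have finK: "finite (GF m :: 'a alg_closure set)" using finite_GF \<open>m > 0\<close> by blast
  have finS: "finite S" using finK S finite_subset by blast
  have "card S < card (GF m :: 'a alg_closure set)"
    using S CARD_field_gt_1[where 'a='a] by (simp add: card_GF \<open>m > 0\<close>)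
  then have "S \<noteq> GF m" by blast
  then obtain y where y: "y \<in> GF m" "y \<notin> S" using S by blast
  let ?Y = "{x + a * y |x a. x \<in> S \<and> a \<in> GF b}"
  have Y: "?Y = (\<lambda>(x, a). x + a * y) ` (S \<times> GF b)" by auto
  have "inj_on (\<lambda>(x, a). x + a * y) (S \<times> GF b)"
  proof (rule inj_onI, clarify)
    fix x a x' a'
    assume *: "x \<in> S" "a \<in> GF b" "x' \<in> S" "a' \<in> GF b" "x + a * y = x' + a' * y"
    have mS: "- x \<in> S"
      using stable_subgroupD(3)[OF S(1) GF_uminus[OF GF_1], of x] * by simp
    have eq: "(a - a') * y = x' + - x" using *(5) by (simp add: algebra_simps)
    \<comment> \<open>Otherwise division by the nonzero element \<open>a - a'\<close> of
      \<open>GF b\<close> would place \<open>y\<close> in \<open>S\<close>.\<close>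
    have "a = a'"
    proof (rule ccontr)
      assume "a \<noteq> a'"
      then have "inverse (a - a') * ((a - a') * y) = y" by simp
      then have "y = inverse (a - a') * (x' + - x)" by (simp only: eq)
      moreover have "inverse (a - a') * (x' + - x) \<in> S"
        using * mS by (intro stable_subgroupD[OF S(1)] GF_inverse GF_diff)
      ultimately show False using y by simp
    qed
    then show "x = x' \<and> a = a'" using * by simp
  qed
  then have "card ?Y = CARD('a) ^ (k + b)"
    unfolding Y by (simp add: card_image card_cartesian_product S card_GF \<open>b > 0\<close> power_add)
  moreover have "stable_subgroup (GF b) ?Y"
    using S(1) by (intro stable_subgroup_adjoin GF_0 GF_add GF_mult)
  moreover have "?Y \<subseteq> GF m"
    using S(2) GF_mono[OF \<open>b dvd m\<close>] y by (auto intro!: GF_add GF_mult)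
  moreover have "S \<subseteq> ?Y"
  proof
    fix x assume "x \<in> S"
    then have "x = x + 0 * y \<and> x \<in> S \<and> 0 \<in> (GF b :: 'a alg_closure set)" by (simp add: GF_0)
    then show "x \<in> ?Y" by blast
  qed
  ultimately show ?thesis by blast
qed

lemma stable_subgroup_exists:
  assumes "b > 0" "b dvd m" "m > 0" "b * s \<le> m"
  shows "\<exists>Y. Y \<subseteq> (GF m :: 'a alg_closure set) \<and> stable_subgroup (GF b) Y \<and> card Y = CARD('a) ^ (b * s)"
  using \<open>b * s \<le> m\<close>
proof (induction s)
  case 0
  have "{0} \<subseteq> (GF m :: 'a alg_closure set) \<and> stable_subgroup (GF b) {0 :: 'a alg_closure}"
    by (auto simp: stable_subgroup_def GF_0)
  then show ?case by (intro exI[of _ "{0}"]) auto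
next
  case (Suc s)
  have lt: "b * s < m" using Suc.prems \<open>b > 0\<close> by simp
  then obtain S :: "'a alg_closure set" where "S \<subseteq> GF m" "stable_subgroup (GF b) S" "card S = CARD('a) ^ (b * s)"
    using Suc.IH by auto
  then show ?case
    using stable_subgroup_chain[OF assms(1-3) _ _ _ lt, of S] by (auto simp: add.commute)
qed

end

section \<open>Top coefficients of linearized polynomials\<close>

context prime_power_field
begin

section \<open>Interpolation by linearized polynomials\<close>

text \<open>By linearity, values on a basis control values on its span. Taking
  \<open>T = {0}\<close> gives vanishing, \<open>T = range to_ac\<close> gives functionals.\<close>

lemma qpoly_in_stable_subgroup:
  assumes "fq_basis n e E" "stable_subgroup (range to_ac) T"
    and "\<And>i. i < n \<Longrightarrow> qpoly k f (e i) \<in> T" and "x \<in> (E :: 'a alg_closure set)"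
  shows "qpoly k f x \<in> T"
proof -
  obtain v where v: "x = comb n e v" using fq_basis_coords[OF assms(1,4)] .
  show ?thesis
    unfolding v qpoly_comb
    by (intro stable_subgroup_sum[OF assms(2)] stable_subgroupD(3)[OF assms(2)] rangeI assms(3)) simp
qed

text \<open>The difference vanishes on all \<open>q ^ n\<close> points of \<open>E\<close>, more
  than the \<open>q ^ (k - 1)\<close> roots it could have.\<close>

lemma qpoly_eqI:
  fixes f g :: "nat \<Rightarrow> 'a alg_closure"
  assumes "fq_basis n e E" "k \<le> n"
    and "\<And>i. i < n \<Longrightarrow> qpoly k f (e i) = qpoly k g (e i)" and "j < k"
  shows "f j = g j"
proof -
  have "f j - g j = 0"
  proof (rule qpoly_coeffs_eq_0[of E k "\<lambda>j. f j - g j"])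
    show "qpoly k (\<lambda>j. f j - g j) x = 0" if "x \<in> E" for x
    proof -
      have "qpoly k (\<lambda>j. f j - g j) x \<in> {0}"
        by (rule qpoly_in_stable_subgroup[OF assms(1) stable_subgroup_zero _ that])
          (simp add: qpoly_diff assms(3))
      then show ?thesis by simp
    qed
    have "CARD('a) ^ (k - 1) < CARD('a) ^ n"
      using CARD_field_gt_1[where 'a='a] assms(2,4) by (intro power_strict_increasing) auto
    then show "CARD('a) ^ (k - 1) < card E"
      by (simp only: card_fq_basis[OF assms(1)])
  qed (rule \<open>j < k\<close>)
  then show ?thesis by simp
qed

text \<open>Values at \<open>k\<close> independent points determine \<open>k\<close> coefficients,
  so evaluation is an injective self-map of a finite set and therefore onto.\<close>

lemma bij_betw_evaluation:
  assumes "fq_basis k e E" "E \<subseteq> (GF m :: 'a alg_closure set)" "m > 0"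
  shows "bij_betw (\<lambda>f. \<lambda>i\<in>{..<k}. qpoly k f (e i)) ({..<k} \<rightarrow>\<^sub>E GF m) ({..<k} \<rightarrow>\<^sub>E GF m)"
    (is "bij_betw ?ev ?P ?P")
proof -
  have fin: "finite ?P" using finite_GF[OF \<open>m > 0\<close>] by (intro finite_PiE) auto
  have inj: "inj_on ?ev ?P"
  proof (rule inj_onI)
    fix f g assume f: "f \<in> ?P" and g: "g \<in> ?P" and eq: "?ev f = ?ev g"
    have "qpoly k f (e i) = qpoly k g (e i)" if "i < k" for i
      using fun_cong[OF eq, of i] that by simp
    then have "f j = g j" if "j < k" for j
      using qpoly_eqI[OF assms(1) order_refl] that by metis
    then show "f = g" by (intro PiE_ext[OF f g]) simp
  qed
  have "?ev ` ?P \<subseteq> ?P"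
  proof (rule image_subsetI)
    fix f assume "f \<in> ?P"
    then show "?ev f \<in> ?P"
      using assms(2) fq_basis_mem[OF assms(1)] by (auto intro!: qpoly_in_GF simp: PiE_iff)
  qed
  then have "?ev ` ?P = ?P"
    using endo_inj_surj[OF fin _ inj] by blast
  then show ?thesis using inj by (simp add: bij_betw_def)
qed

lemma card_qpolys_with_values:
  assumes "fq_basis k e E" "E \<subseteq> (GF m :: 'a alg_closure set)" "m > 0"
    and "\<And>i. i < k \<Longrightarrow> T i \<subseteq> GF m"
  shows "card {f \<in> {..<k} \<rightarrow>\<^sub>E GF m. \<forall>i<k. qpoly k f (e i) \<in> T i} = (\<Prod>i<k. card (T i))"
proof -
  let ?ev = "\<lambda>f. \<lambda>i\<in>{..<k}. qpoly k f (e i)"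
  let ?G = "{f \<in> {..<k} \<rightarrow>\<^sub>E GF m. \<forall>i<k. qpoly k f (e i) \<in> T i}"
  note bij = bij_betw_evaluation[OF assms(1-3)]
  have im: "?ev ` ?G = (\<Pi>\<^sub>E i\<in>{..<k}. T i)"
  proof (intro equalityI image_subsetI subsetI)
    fix f assume "f \<in> ?G"
    then show "?ev f \<in> (\<Pi>\<^sub>E i\<in>{..<k}. T i)"
      unfolding restrict_PiE_iff by simp
  next
    fix t assume t: "t \<in> (\<Pi>\<^sub>E i\<in>{..<k}. T i)"
    have "t \<in> {..<k} \<rightarrow>\<^sub>E GF m"
      by (rule subsetD[OF PiE_mono t]) (simp add: assms(4))
    then have "t \<in> ?ev ` ({..<k} \<rightarrow>\<^sub>E GF m)"
      using bij unfolding bij_betw_def by (simp only:)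
    then obtain f where f: "t = ?ev f" "f \<in> {..<k} \<rightarrow>\<^sub>E GF m" by (rule imageE)
    have "qpoly k f (e i) \<in> T i" if "i < k" for i
    proof -
      have "t i \<in> T i" using PiE_mem[OF t] that by simp
      then show ?thesis unfolding f(1) using that by simp
    qed
    then have "f \<in> ?G" using f(2) by simp
    then show "t \<in> ?ev ` ?G" unfolding f(1) by (rule imageI)
  qed
  have "inj_on ?ev ?G"
    by (rule inj_on_subset[OF bij_betw_imp_inj_on[OF bij]]) (rule Collect_restrict)
  then have "card ?G = card (?ev ` ?G)"
    by (rule card_image[symmetric])
  then show ?thesis by (simp only: im card_PiE finite_lessThan)
qed

text \<open>An injective self-map of a finite set is onto. Twisting by \<open>a'\<close> scales the
  top coefficient by \<open>a' ^ (q ^ l)\<close>, so such roots are needed to reach every scalar of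
  \<open>GF b\<close>.\<close>

lemma frobenius_surj_GF:
  assumes "a \<in> (GF b :: 'a alg_closure set)" "b > 0"
  obtains a' where "a' \<in> GF b" "a' ^ (CARD('a) ^ l) = a"
proof -
  have "inj_on (\<lambda>x. x ^ (CARD('a) ^ l)) (GF b :: 'a alg_closure set)"
    by (rule inj_onI) (rule frobenius_inj)
  then have "(\<lambda>x. x ^ (CARD('a) ^ l)) ` GF b = (GF b :: 'a alg_closure set)"
    by (intro endo_inj_surj finite_GF[OF \<open>b > 0\<close>] image_subsetI GF_power)
  with assms(1) have "a \<in> (\<lambda>x. x ^ (CARD('a) ^ l)) ` GF b" by (simp only:)
  then show ?thesis
  proof (rule imageE)
    fix a' :: "'a alg_closure" assume "a = a' ^ (CARD('a) ^ l)" "a' \<in> GF b"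
    then show ?thesis by (intro that[of a']) simp_all
  qed
qed

end

text \<open>\<open>E'\<close> is a subspace of codimension \<open>b\<close> in \<open>E\<close>,
  spanned by an initial part of the same basis. Stability under \<open>GF b\<close> allows
  functionals to be precomposed with multiplications from \<open>GF b\<close>.\<close>

locale evaluation_basis = prime_power_field ty for ty :: "'a::{field,finite} itself" +
  fixes b l m :: nat and e :: "nat \<Rightarrow> 'a alg_closure" and E' E :: "'a alg_closure set"
  assumes b: "b > 0" "b dvd m" "b \<le> l + 1" and l: "l > 0" and m: "m > 0"
    and basis': "fq_basis (l + 1 - b) e E'" and basis: "fq_basis (l + 1) e E"
    and stable': "stable_subgroup (GF b) E'" and stable: "stable_subgroup (GF b) E"
    and E: "E \<subseteq> GF m"
begin

text \<open>By interpolation these represent all base-field-linear functionals on \<open>E\<close>,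
  each by exactly one tuple of coefficients.\<close>

definition functionals :: "(nat \<Rightarrow> 'a alg_closure) set" where
  "functionals = {f \<in> {..<l + 1} \<rightarrow>\<^sub>E GF m. \<forall>i<l + 1. qpoly (l + 1) f (e i) \<in> range to_ac}"

text \<open>The space \<open>W\<close> of the opening overview.\<close>

definition leading :: "'a alg_closure set" where
  "leading = (\<lambda>f. f l) ` functionals"

definition twist :: "(nat \<Rightarrow> 'a alg_closure) \<Rightarrow> 'a alg_closure \<Rightarrow> nat \<Rightarrow> 'a alg_closure" where
  "twist f a = (\<lambda>j\<in>{..<l + 1}. f j * a ^ (CARD('a) ^ j))"

lemma qpoly_twist: "qpoly (l + 1) (twist f a) x = qpoly (l + 1) f (a * x)"
proof -
  have "qpoly (l + 1) (twist f a) x = qpoly (l + 1) (\<lambda>j. f j * a ^ (CARD('a) ^ j)) x"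
    by (rule qpoly_cong) (simp add: twist_def)
  then show ?thesis by (simp only: qpoly_mult_arg)
qed

lemma functionals_on_E:
  assumes "f \<in> functionals" "x \<in> E"
  shows "qpoly (l + 1) f x \<in> range to_ac"
  using assms(1) unfolding functionals_def
  by (intro qpoly_in_stable_subgroup[OF basis stable_subgroup_range_to_ac _ assms(2)]) blast

lemma twist_in_functionals:
  assumes f: "f \<in> functionals" and a: "a \<in> GF b"
  shows "twist f a \<in> functionals"
  unfolding functionals_def
proof (intro CollectI conjI allI impI)
  have "a \<in> GF m" using GF_mono[OF b(2)] a by blast
  then show "twist f a \<in> {..<l + 1} \<rightarrow>\<^sub>E GF m"
    using f by (auto simp: twist_def functionals_def PiE_iff intro!: GF_mult GF_power)
  fix i assume "i < l + 1"
  then have "a * e i \<in> E"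
    by (intro stable_subgroupD(3)[OF stable a] fq_basis_mem[OF basis])
  then show "qpoly (l + 1) (twist f a) (e i) \<in> range to_ac"
    unfolding qpoly_twist by (rule functionals_on_E[OF f])
qed

lemma zero_in_functionals: "(\<lambda>j\<in>{..<l + 1}. 0) \<in> functionals"
proof -
  have "qpoly (l + 1) (\<lambda>j\<in>{..<l + 1}. 0) x = (0 :: 'a alg_closure)" for x :: "'a alg_closure"
    by (simp add: qpoly_def)
  then show ?thesis
    using range_to_ac_0 by (simp add: functionals_def PiE_iff GF_0 del: One_nat_def)
qed

lemma add_in_functionals:
  assumes "f \<in> functionals" "g \<in> functionals"
  shows "(\<lambda>j\<in>{..<l + 1}. f j + g j) \<in> functionals"
proof -
  have "qpoly (l + 1) (\<lambda>j\<in>{..<l + 1}. f j + g j) x = qpoly (l + 1) f x + qpoly (l + 1) g x" for x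
    unfolding qpoly_add[symmetric] by (rule qpoly_cong) simp
  then show ?thesis
    using assms by (auto simp: functionals_def PiE_iff intro!: GF_add range_to_ac_closed
        simp del: One_nat_def)
qed

text \<open>A nonzero functional on \<^term>\<open>E\<close> vanishes on \<^term>\<open>CARD('a) ^ l\<close> points, too many for
  a \<^const>\<open>qpoly\<close> with fewer than \<^term>\<open>l + 1\<close> coefficients.\<close>

lemma leading_coeff_inj: "inj_on (\<lambda>f. f l) functionals"
proof (rule inj_onI)
  fix f g assume f: "f \<in> functionals" and g: "g \<in> functionals" and eq: "f l = g l"
  let ?d = "\<lambda>j. f j - g j"
  let ?N = "{x \<in> E. qpoly l ?d x = 0}"
  \<comment> \<open>The terms of index \<open>l\<close> cancel because the top coefficients agree,
    leaving only \<open>l\<close> coefficients.\<close>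
  have d: "qpoly l ?d x = qpoly (l + 1) f x - qpoly (l + 1) g x" for x
    using eq by (simp add: qpoly_diff[symmetric] qpoly_Suc)
  have "qpoly l ?d ` E \<subseteq> range to_ac"
  proof (rule image_subsetI)
    fix x assume x: "x \<in> E"
    obtain a a' where "qpoly (l + 1) f x = to_ac a" "qpoly (l + 1) g x = to_ac a'"
      using functionals_on_E[OF f x] functionals_on_E[OF g x] by (elim imageE)
    then have "qpoly l ?d x = to_ac (a - a')" by (simp only: d to_ac_diff)
    then show "qpoly l ?d x \<in> range to_ac" by (simp only: rangeI)
  qed
  then have "card (qpoly l ?d ` E) \<le> card (range (to_ac :: 'a \<Rightarrow> _))"
    by (intro card_mono) auto
  then have im: "card (qpoly l ?d ` E) \<le> CARD('a)"
    by (simp add: card_image inj_to_ac)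
  have fin: "finite E" by (rule finite_fq_basis[OF basis])
  have "card E \<le> card (qpoly l ?d ` E) * card ?N"
  proof (rule card_le_image_times_fibre[where d = "\<lambda>x y. x - y"])
    fix x y assume xy: "x \<in> E" "y \<in> E" "qpoly l ?d x = qpoly l ?d y"
    obtain v where v: "x = comb (l + 1) e v" by (rule fq_basis_coords[OF basis xy(1)])
    obtain w where w: "y = comb (l + 1) e w" by (rule fq_basis_coords[OF basis xy(2)])
    have eq: "x - y = comb (l + 1) e (\<lambda>i. v i - w i)" by (simp only: comb_diff v w)
    have "x - y \<in> E" unfolding eq by (rule fq_basis_comb_in[OF basis])
    moreover have "qpoly l ?d (x - y) = qpoly l ?d x - qpoly l ?d y"
      unfolding eq unfolding v w qpoly_comb by (simp only: to_ac_diff left_diff_distrib sum_subtractf)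
    ultimately show "x - y \<in> ?N" using xy(3) by simp
  qed (simp_all add: fin inj_on_def)
  also have "\<dots> \<le> CARD('a) * card ?N"
    using im by (rule mult_right_mono) simp
  finally have "CARD('a) ^ l \<le> card ?N"
    by (simp add: card_fq_basis[OF basis])
  moreover have "CARD('a) ^ (l - 1) < CARD('a) ^ l"
    using CARD_field_gt_1[where 'a='a] l by (intro power_strict_increasing) simp_all
  ultimately have card: "CARD('a) ^ (l - 1) < card ?N" by linarith
  have "?d j = 0" if "j < l" for j
    by (rule qpoly_coeffs_eq_0[OF _ card that]) simp
  then have eqj: "f j = g j" if "j < l + 1" for j
    using eq that by (cases "j = l") simp_all
  have "f \<in> {..<l + 1} \<rightarrow>\<^sub>E GF m" "g \<in> {..<l + 1} \<rightarrow>\<^sub>E GF m"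
    using f g unfolding functionals_def by blast+
  then show "f = g" by (rule PiE_ext) (use eqj in blast)
qed

lemma card_leading: "card leading = CARD('a) ^ (l + 1)"
proof -
  have "card leading = card functionals"
    unfolding leading_def by (rule card_image[OF leading_coeff_inj])
  also have "\<dots> = (\<Prod>i<l + 1. card (range (to_ac :: 'a \<Rightarrow> _)))"
    unfolding functionals_def using to_ac_in_GF
    by (intro card_qpolys_with_values[OF basis E m]) auto
  finally show ?thesis by (simp add: card_image inj_to_ac)
qed

lemma leading_subset: "leading \<subseteq> GF m"
  by (auto simp: leading_def functionals_def PiE_iff)

text \<open>Scaling by \<open>a\<close> is realised by twisting with the \<open>q ^ l\<close>-th
  root of \<open>a\<close> in \<open>GF b\<close>.\<close>

lemma leading_stable: "stable_subgroup (GF b) leading"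
  unfolding stable_subgroup_def
proof (intro conjI ballI)
  show "0 \<in> leading"
    unfolding leading_def by (rule image_eqI[OF _ zero_in_functionals]) simp
next
  fix x y assume "x \<in> leading" "y \<in> leading"
  then obtain f g where fg: "f \<in> functionals" "g \<in> functionals" "x = f l" "y = g l"
    unfolding leading_def by blast
  show "x + y \<in> leading"
    unfolding leading_def by (rule image_eqI[OF _ add_in_functionals[OF fg(1,2)]]) (simp add: fg(3,4))
next
  fix a x :: "'a alg_closure" assume a: "a \<in> GF b" and "x \<in> leading"
  then obtain f where f: "f \<in> functionals" "x = f l"
    unfolding leading_def by blast
  obtain a' where "a' \<in> GF b" "a' ^ (CARD('a) ^ l) = a"
    using frobenius_surj_GF[OF a b(1)] .
  with f show "a * x \<in> leading"
    unfolding leading_def by (intro image_eqI[OF _ twist_in_functionals]) (simp_all add: twist_def)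
qed

text \<open>Interpolation of the unit tuples gives the dual basis; an index \<open>i\<close> beyond
  \<open>l\<close> yields the zero functional.\<close>

lemma dual_functionals:
  "\<exists>\<phi>. \<forall>i. \<phi> i \<in> functionals \<and> (\<forall>k<l + 1. qpoly (l + 1) (\<phi> i) (e k) = (if k = i then 1 else 0))"
proof -
  have "\<exists>f. f \<in> functionals \<and> (\<forall>k<l + 1. qpoly (l + 1) f (e k) = (if k = i then 1 else 0))" for i
  proof -
    let ?t = "\<lambda>k\<in>{..<l + 1}. if k = i then 1 else (0 :: 'a alg_closure)"
    let ?ev = "\<lambda>f. \<lambda>k\<in>{..<l + 1}. qpoly (l + 1) f (e k)"
    have "?t \<in> {..<l + 1} \<rightarrow>\<^sub>E GF m"
      unfolding restrict_PiE_iff by (simp add: GF_0 GF_1)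
    then have "?t \<in> ?ev ` ({..<l + 1} \<rightarrow>\<^sub>E GF m)"
      using bij_betw_evaluation[OF basis E m] unfolding bij_betw_def by (simp only:)
    then obtain f where f: "?t = ?ev f" "f \<in> {..<l + 1} \<rightarrow>\<^sub>E GF m" by (rule imageE)
    have val: "qpoly (l + 1) f (e k) = (if k = i then 1 else 0)" if "k < l + 1" for k
      using fun_cong[OF f(1), of k] that by (simp split: if_splits)
    have "qpoly (l + 1) f (e k) \<in> range to_ac" if "k < l + 1" for k
    proof -
      have "qpoly (l + 1) f (e k) = to_ac (if k = i then 1 else 0)" using val[OF that] by simp
      then show ?thesis by (simp only: rangeI)
    qed
    then have "f \<in> functionals" using f(2) unfolding functionals_def by simp
    then show ?thesis using val by (intro exI[of _ f]) simp
  qed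
  then have "\<forall>i. \<exists>f. f \<in> functionals \<and> (\<forall>k<l + 1. qpoly (l + 1) f (e k) = (if k = i then 1 else 0))"
    by (rule allI)
  then show ?thesis by (rule choice)
qed

lemma twist_leading: "twist f a l = f l * a ^ (CARD('a) ^ l)"
  by (simp add: twist_def)

lemma inj_twist:
  assumes "f l \<noteq> 0"
  shows "inj_on (twist f) A"
proof (rule inj_onI)
  fix a a' assume "twist f a = twist f a'"
  then have "f l * a ^ (CARD('a) ^ l) = f l * a' ^ (CARD('a) ^ l)"
    by (simp only: twist_leading[symmetric])
  then have "a ^ (CARD('a) ^ l) = a' ^ (CARD('a) ^ l)" using assms by simp
  then show "a = a'" by (rule frobenius_inj)
qed

text \<open>The functionals vanishing on \<^term>\<open>E'\<close> form a line over \<^term>\<open>GF b\<close>, since there are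
  at most \<^term>\<open>CARD('a) ^ b\<close> of them and any nonzero one has that many twists.\<close>

lemma functionals_vanishing_on_E':
  assumes f: "f \<in> functionals" "\<And>i. i < l + 1 - b \<Longrightarrow> qpoly (l + 1) f (e i) = 0" and "f l \<noteq> 0"
    and g: "g \<in> functionals" "\<And>i. i < l + 1 - b \<Longrightarrow> qpoly (l + 1) g (e i) = 0"
  shows "\<exists>a\<in>GF b. g l = f l * a"
proof -
  let ?T = "\<lambda>i. if i < l + 1 - b then {0} else range (to_ac :: 'a \<Rightarrow> _)"
  let ?L = "{f \<in> {..<l + 1} \<rightarrow>\<^sub>E GF m. \<forall>i<l + 1. qpoly (l + 1) f (e i) \<in> ?T i}"
  have L: "h \<in> ?L" if "h \<in> functionals" "\<And>i. i < l + 1 - b \<Longrightarrow> qpoly (l + 1) h (e i) = 0" for h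
    using that unfolding functionals_def by auto
  have "card ?L = (\<Prod>i<l + 1. card (?T i))"
    using to_ac_in_GF GF_0 by (intro card_qpolys_with_values[OF basis E m]) auto
  \<comment> \<open>The value at each basis vector of \<open>E'\<close> is forced to be 0, and each
    of the other \<open>b\<close> values is free in the base field.\<close>
  also have "\<dots> = (\<Prod>i\<in>{..<l + 1 - b} \<union> {l + 1 - b..<l + 1}. card (?T i))"
    by (rule prod.cong) (use b(3) in auto)
  also have "\<dots> = (\<Prod>i<l + 1 - b. card (?T i)) * (\<Prod>i = l + 1 - b..<l + 1. card (?T i))"
    by (rule prod.union_disjoint) auto
  also have "\<dots> = CARD('a) ^ b"
    using b(3) by (simp add: card_image inj_to_ac)
  finally have cardL: "card ?L = CARD('a) ^ b" .
  have "twist f ` GF b \<subseteq> ?L"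
  proof (rule image_subsetI, rule L)
    fix a :: "'a alg_closure" assume a: "a \<in> GF b"
    show "twist f a \<in> functionals" by (rule twist_in_functionals[OF f(1) a])
    fix i assume "i < l + 1 - b"
    then have ae: "a * e i \<in> E'"
      by (intro stable_subgroupD(3)[OF stable' a] fq_basis_mem[OF basis'])
    have "qpoly (l + 1) f (a * e i) \<in> {0}"
      by (rule qpoly_in_stable_subgroup[OF basis' stable_subgroup_zero _ ae]) (simp only: f(2) singleton_iff)
    then show "qpoly (l + 1) (twist f a) (e i) = 0"
      unfolding qpoly_twist by simp
  qed
  moreover have "card (twist f ` GF b) = CARD('a) ^ b"
    using card_GF[OF b(1)] by (simp add: card_image inj_twist \<open>f l \<noteq> 0\<close>)
  moreover have "finite ?L"
    by (rule card_ge_0_finite) (simp only: cardL, simp)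
  ultimately have "twist f ` GF b = ?L"
    using cardL by (intro card_subset_eq) simp_all
  with L[OF g] have "g \<in> twist f ` GF b" by (simp only:)
  then obtain a where "g = twist f a" "a \<in> GF b" by (rule imageE)
  then have "g l = f l * a ^ (CARD('a) ^ l)" "a ^ (CARD('a) ^ l) \<in> GF b"
    by (simp_all add: twist_leading GF_power)
  then show ?thesis by (rule bexI)
qed

text \<open>The counting core. Polynomials with \<open>l + 1\<close> coefficients can be given
  arbitrary values in the prescribed sets, which yields the left-hand side. Their top coefficients
  lie in \<open>leading\<close>, so at most \<open>q ^ (l + 1)\<close> occur, and polynomials
  sharing one differ by a polynomial with only \<open>l\<close> coefficients.\<close>

lemma exists_scaled_leading:
  obtains V where "stable_subgroup (GF b) V" "GF b \<subseteq> V" "V \<subseteq> GF m" "card V = CARD('a) ^ (l + 1)"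
    "CARD('a) ^ ((l + 1 - b) * b + (l + 1) * b) \<le> CARD('a) ^ (l + 1) *
      card {f \<in> {..<l} \<rightarrow>\<^sub>E GF m. \<forall>i<l + 1. qpoly l f (e i) \<in> (if i < l + 1 - b then GF b else V)}"
proof -
  obtain \<phi> :: "nat \<Rightarrow> nat \<Rightarrow> 'a alg_closure" where all: "\<forall>i. \<phi> i \<in> functionals \<and>
      (\<forall>k<l + 1. qpoly (l + 1) (\<phi> i) (e k) = (if k = i then 1 else 0))"
    using dual_functionals by (rule exE)
  have \<phi>: "\<phi> i \<in> functionals"
      "k < l + 1 \<Longrightarrow> qpoly (l + 1) (\<phi> i) (e k) = (if k = i then 1 else 0)" for i k
    by (simp_all only: all)
  \<comment> \<open>Scaling \<open>leading\<close> by the inverse of \<open>c\<close> puts 1, hence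
    \<open>GF b\<close>, into \<open>V\<close>. If \<open>c\<close> were 0, the functional
    \<open>\<phi> l\<close> would vanish, against its value 1 at \<open>e l\<close>.\<close>
  define c where "c = \<phi> l l"
  have "c \<noteq> 0"
  proof
    assume "c = 0"
    then have "\<phi> l l = (\<lambda>j\<in>{..<l + 1}. 0) l" by (simp add: c_def)
    then have "\<phi> l = (\<lambda>j\<in>{..<l + 1}. 0)"
      by (rule inj_onD[OF leading_coeff_inj _ \<phi>(1) zero_in_functionals])
    then have "qpoly (l + 1) (\<phi> l) (e l) = 0" by (simp add: qpoly_def)
    then show False using \<phi>(2)[of l l] by simp
  qed
  have phi_W: "\<phi> i l \<in> leading" if "i < l + 1" for i
    unfolding leading_def by (rule imageI[OF \<phi>(1)])
  then have cW: "c \<in> leading" by (simp add: c_def)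
  define V where "V = {x. c * x \<in> leading}"
  have V_image: "V = (\<lambda>w. inverse c * w) ` leading"
  proof (intro equalityI subsetI)
    fix x assume "x \<in> V"
    then have "c * x \<in> leading" by (simp add: V_def)
    moreover have "x = inverse c * (c * x)" using \<open>c \<noteq> 0\<close> by simp
    ultimately show "x \<in> (\<lambda>w. inverse c * w) ` leading" by (intro image_eqI)
  next
    fix x assume "x \<in> (\<lambda>w. inverse c * w) ` leading"
    then obtain w where w: "x = inverse c * w" "w \<in> leading" by (rule imageE)
    have "c * (inverse c * w) = w" using \<open>c \<noteq> 0\<close> by simp
    then show "x \<in> V" unfolding V_def w(1) using w(2) by (simp only: mem_Collect_eq)
  qed
  have V1: "stable_subgroup (GF b) V"
    unfolding stable_subgroup_def
  proof (intro conjI ballI)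
    show "0 \<in> V" using stable_subgroupD(1)[OF leading_stable] by (simp add: V_def)
    show "x + y \<in> V" if "x \<in> V" "y \<in> V" for x y
      using that stable_subgroupD(2)[OF leading_stable, of "c * x" "c * y"]
      by (simp add: V_def distrib_left)
    show "a * x \<in> V" if "a \<in> GF b" "x \<in> V" for a x
    proof -
      have "a * (c * x) \<in> leading"
        using that(2) by (intro stable_subgroupD(3)[OF leading_stable that(1)]) (simp add: V_def)
      then show ?thesis unfolding V_def mem_Collect_eq by (simp only: mult.left_commute)
    qed
  qed
  have V2: "GF b \<subseteq> V"
  proof
    fix x :: "'a alg_closure" assume "x \<in> GF b"
    then have "x * c \<in> leading" by (rule stable_subgroupD(3)[OF leading_stable _ cW])
    then show "x \<in> V" unfolding V_def mem_Collect_eq by (simp only: mult.commute)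
  qed
  have V3: "V \<subseteq> GF m"
    unfolding V_image
    by (intro image_subsetI GF_mult GF_inverse subsetD[OF leading_subset] cW)
  have "inj_on (\<lambda>w. inverse c * w) leading"
    using \<open>c \<noteq> 0\<close> by (simp add: inj_on_def)
  then have V4: "card V = CARD('a) ^ (l + 1)"
    unfolding V_image card_leading[symmetric] by (rule card_image)
  let ?T = "\<lambda>i. if i < l + 1 - b then GF b else V"
  let ?G = "{f \<in> {..<l + 1} \<rightarrow>\<^sub>E GF m. \<forall>i<l + 1. qpoly (l + 1) f (e i) \<in> ?T i}"
  let ?N = "{f \<in> {..<l} \<rightarrow>\<^sub>E GF m. \<forall>i<l + 1. qpoly l f (e i) \<in> ?T i}"
  have T: "stable_subgroup (GF b) (?T i)" for i
    using V1 stable_subgroup_GF[of b b] by simp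
  have lead: "(\<lambda>f. f l) ` ?G \<subseteq> leading"
  proof (rule image_subsetI)
    fix f assume f: "f \<in> ?G"
    have delta: "a * (if k = i then 1 else 0) = (if i = k then a else 0)"
      for a :: "'a alg_closure" and i k :: nat by simp
    have fT: "qpoly (l + 1) f (e i) \<in> ?T i" if "i < l + 1" for i
      using f that by blast
    \<comment> \<open>Expansion in the dual basis: both polynomials agree at all
      \<open>l + 1\<close> basis points, so their top coefficients agree too.\<close>
    have "f l = (\<Sum>i<l + 1. qpoly (l + 1) f (e i) * \<phi> i l)"
    proof (rule qpoly_eqI[OF basis order_refl, of f "\<lambda>j. \<Sum>i<l + 1. qpoly (l + 1) f (e i) * \<phi> i j"])
      fix k assume k: "k < l + 1"
      have "qpoly (l + 1) (\<lambda>j. \<Sum>i<l + 1. qpoly (l + 1) f (e i) * \<phi> i j) (e k)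
          = (\<Sum>i<l + 1. qpoly (l + 1) f (e i) * qpoly (l + 1) (\<phi> i) (e k))"
        by (simp only: qpoly_sum qpoly_scale)
      also have "\<dots> = (\<Sum>i<l + 1. if i = k then qpoly (l + 1) f (e i) else 0)"
          by (intro sum.cong refl) (simp only: \<phi>(2)[OF k] delta)
      also have "\<dots> = qpoly (l + 1) f (e k)" using k by simp
      finally show "qpoly (l + 1) f (e k)
          = qpoly (l + 1) (\<lambda>j. \<Sum>i<l + 1. qpoly (l + 1) f (e i) * \<phi> i j) (e k)"
        by (rule sym)
    qed simp
    also have "\<dots> \<in> leading"
    proof (rule stable_subgroup_sum[OF leading_stable])
      fix i assume "i \<in> {..<l + 1}"
      then have i: "i < l + 1" by simp
      show "qpoly (l + 1) f (e i) * \<phi> i l \<in> leading"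
      proof (cases "i < l + 1 - b")
        case True
        then have "qpoly (l + 1) f (e i) \<in> GF b" using fT[OF i] by simp
        then show ?thesis by (rule stable_subgroupD(3)[OF leading_stable _ phi_W[OF i]])
      next
        case False
        then have V: "c * qpoly (l + 1) f (e i) \<in> leading"
          using fT[OF i] unfolding V_def by simp
        \<comment> \<open>Both \<open>i\<close> and \<open>l\<close> are at least
          \<open>l + 1 - b\<close>, so both dual functionals vanish on \<open>E'\<close> and lie on
          one line over \<open>GF b\<close>.\<close>
        have "\<exists>a\<in>GF b. \<phi> i l = \<phi> l l * a"
        proof (rule functionals_vanishing_on_E'[of "\<phi> l" "\<phi> i"])
          show "\<phi> l \<in> functionals" "\<phi> i \<in> functionals" by (rule \<phi>(1))+
          show "\<phi> l l \<noteq> 0" using \<open>c \<noteq> 0\<close> by (simp add: c_def)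
          show "qpoly (l + 1) (\<phi> l) (e k) = 0" if "k < l + 1 - b" for k
            using \<phi>(2)[of k l] that b(1) by simp
          show "qpoly (l + 1) (\<phi> i) (e k) = 0" if "k < l + 1 - b" for k
            using \<phi>(2)[of k i] that False by auto
        qed
        then obtain a where a: "a \<in> GF b" "\<phi> i l = \<phi> l l * a" by (rule bexE)
        have "a * (c * qpoly (l + 1) f (e i)) \<in> leading"
          by (rule stable_subgroupD(3)[OF leading_stable a(1) V])
        moreover have "qpoly (l + 1) f (e i) * \<phi> i l = a * (c * qpoly (l + 1) f (e i))"
          by (simp only: a(2) c_def mult_ac)
        ultimately show ?thesis by (simp only:)
      qed
    qed
    finally show "f l \<in> leading" .
  qed
  have finG: "finite ({..<k} \<rightarrow>\<^sub>E (GF m :: 'a alg_closure set))" for k :: nat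
    using finite_GF[OF m] by (intro finite_PiE) auto
  have fl: "finite leading" by (rule card_ge_0_finite) (simp only: card_leading, simp)
  have "card ?G = (\<Prod>i<l + 1. card (?T i))"
    using V3 GF_mono[OF b(2)] by (intro card_qpolys_with_values[OF basis E m]) auto
  also have "\<dots> = (\<Prod>i\<in>{..<l + 1 - b} \<union> {l + 1 - b..<l + 1}. card (?T i))"
    by (rule prod.cong) (use b(3) in auto)
  also have "\<dots> = (\<Prod>i<l + 1 - b. card (?T i)) * (\<Prod>i = l + 1 - b..<l + 1. card (?T i))"
    by (rule prod.union_disjoint) auto
  also have "\<dots> = CARD('a) ^ ((l + 1 - b) * b + (l + 1) * b)"
  proof -
    have "(\<Prod>i<l + 1 - b. card (?T i)) = CARD('a) ^ ((l + 1 - b) * b)"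
      using card_GF[OF b(1)] by (simp add: power_mult[symmetric] mult.commute)
    moreover have "(\<Prod>i = l + 1 - b..<l + 1. card (?T i)) = (CARD('a) ^ (l + 1)) ^ b"
      using V4 b(3) by simp
    ultimately show ?thesis by (simp only: power_add power_mult)
  qed
  finally have "CARD('a) ^ ((l + 1 - b) * b + (l + 1) * b) = card ?G"
    by (rule sym)
  also have "\<dots> \<le> card ((\<lambda>f. f l) ` ?G) * card ?N"
  proof (rule card_le_image_times_fibre[where d = "\<lambda>f g. \<lambda>j\<in>{..<l}. f j - g j"])
    show "finite ?G" by (rule finite_subset[OF Collect_restrict finG])
    show "finite ?N" by (rule finite_subset[OF Collect_restrict finG])
    show "(\<lambda>j\<in>{..<l}. f j - g j) \<in> ?N" if f: "f \<in> ?G" and g: "g \<in> ?G" and eq: "f l = g l" for f g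
    proof (intro CollectI conjI allI impI)
      show "(\<lambda>j\<in>{..<l}. f j - g j) \<in> {..<l} \<rightarrow>\<^sub>E GF m"
        using f g by (auto simp: PiE_iff intro!: GF_diff)
      fix i assume i: "i < l + 1"
      have "qpoly l (\<lambda>j\<in>{..<l}. f j - g j) (e i) = qpoly l (\<lambda>j. f j - g j) (e i)"
        by (rule qpoly_cong) simp
      \<comment> \<open>The difference is written with the scalar \<open>- 1\<close> of
        \<open>GF b\<close>, since stability speaks of sums and multiples.\<close>
      also have "\<dots> = qpoly (l + 1) f (e i) + (- 1) * qpoly (l + 1) g (e i)"
        using eq by (simp add: qpoly_diff qpoly_Suc)
      also have "\<dots> \<in> ?T i"
        using f g i by (intro stable_subgroupD(2)[OF T] stable_subgroupD(3)[OF T GF_uminus[OF GF_1]]) blast+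
      finally show "qpoly l (\<lambda>j\<in>{..<l}. f j - g j) (e i) \<in> ?T i" .
    qed
    show "inj_on (\<lambda>f. \<lambda>j\<in>{..<l}. f j - g j) {f \<in> ?G. f l = g l}" for g
    proof (rule inj_onI)
      fix f f' assume f: "f \<in> {f \<in> ?G. f l = g l}" and f': "f' \<in> {f \<in> ?G. f l = g l}"
        and eq: "(\<lambda>j\<in>{..<l}. f j - g j) = (\<lambda>j\<in>{..<l}. f' j - g j)"
      have eqj: "f j = f' j" if "j < l + 1" for j
      proof (cases "j = l")
        case True
        then show ?thesis using f f' by simp
      next
        case False
        then show ?thesis using fun_cong[OF eq, of j] that by simp
      qed
      have "f \<in> {..<l + 1} \<rightarrow>\<^sub>E GF m" "f' \<in> {..<l + 1} \<rightarrow>\<^sub>E GF m" using f f' by blast+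
      then show "f = f'" by (rule PiE_ext) (use eqj in blast)
    qed
  qed
  also have "\<dots> \<le> CARD('a) ^ (l + 1) * card ?N"
    using card_mono[OF fl lead] card_leading by (intro mult_right_mono) simp_all
  finally show ?thesis by (rule that[OF V1 V2 V3 V4])
qed

end

section \<open>Dimension and rank over a finite field\<close>

text \<open>Every vector has unique coordinates in a basis. This converts dimension and rank into
  cardinalities, which are what the proof compares.\<close>

lemma (in vectorspace) card_carrier_eq_power_dim:
  assumes "finite (carrier V)"
  shows "card (carrier V) = card (carrier K) ^ dim"
proof -
  have "span (carrier V) = carrier V"
    by (intro equalityI in_own_span span_is_subset2) simp_all
  then have "fin_dim"
    unfolding fin_dim_def using assms by (intro exI[of _ "carrier V"]) simp
  then obtain B where B: "finite B" "basis B"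
    using finite_basis_exists by auto
  have BV: "B \<subseteq> carrier V" using B(2) unfolding basis_def by simp
  have uniq: "\<exists>!a. a \<in> B \<rightarrow>\<^sub>E carrier K \<and> lincomb a B = v" if "v \<in> carrier V" for v
    using basis_criterion[OF B(1) BV] B(2) that by simp
  have closed: "lincomb a B \<in> carrier V" if "a \<in> B \<rightarrow>\<^sub>E carrier K" for a
    using that by (intro lincomb_closed BV) (simp add: PiE_iff Pi_iff)
  have "bij_betw (\<lambda>a. lincomb a B) (B \<rightarrow>\<^sub>E carrier K) (carrier V)"
    unfolding bij_betw_def
  proof (intro conjI equalityI subsetI)
    show "inj_on (\<lambda>a. lincomb a B) (B \<rightarrow>\<^sub>E carrier K)"
    proof (rule inj_onI)
      fix a a' assume a: "a \<in> B \<rightarrow>\<^sub>E carrier K" "a' \<in> B \<rightarrow>\<^sub>E carrier K" "lincomb a B = lincomb a' B"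
      from ex1_implies_ex[OF uniq[OF closed[OF a(1)]]] uniq[OF closed[OF a(1)]] a
      show "a = a'" by metis
    qed
    fix v assume "v \<in> carrier V"
    from ex1_implies_ex[OF uniq[OF this]] obtain a
      where "a \<in> B \<rightarrow>\<^sub>E carrier K" "lincomb a B = v" by auto
    then show "v \<in> (\<lambda>a. lincomb a B) ` (B \<rightarrow>\<^sub>E carrier K)" by (intro image_eqI) simp_all
  next
    fix v assume "v \<in> (\<lambda>a. lincomb a B) ` (B \<rightarrow>\<^sub>E carrier K)"
    then show "v \<in> carrier V" using closed by (elim imageE) simp
  qed
  then have "card (carrier V) = card (B \<rightarrow>\<^sub>E carrier K)"
    by (simp only: bij_betw_same_card)
  also have "\<dots> = card (carrier K) ^ card B"
    by (simp add: card_PiE B(1))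
  finally show ?thesis using dim_basis[OF B] by simp
qed

lemma card_mat_subspace:
  fixes C :: "'a::{field,finite} mat set"
  assumes "VectorSpace.subspace class_ring C (mat_space TYPE('a) m n)" "finite C"
  shows "card C = CARD('a) ^ vectorspace.dim class_ring ((mat_space TYPE('a) m n)\<lparr>carrier := C\<rparr>)"
proof -
  interpret V: vectorspace class_ring "mat_space TYPE('a) m n"
    by (rule vectorspace_mat_space)
  interpret W: vectorspace class_ring "(mat_space TYPE('a) m n)\<lparr>carrier := C\<rparr>"
    by (rule V.subspace_is_vs[OF assms(1)])
  show ?thesis using W.card_carrier_eq_power_dim assms(2) by simp
qed

lemma carrier_vec_eq_image: "carrier_vec n = vec n ` ({..<n} \<rightarrow>\<^sub>E UNIV)"
proof (intro equalityI subsetI)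
  fix v :: "'a vec" assume "v \<in> carrier_vec n"
  then have eq: "v = vec n (\<lambda>i\<in>{..<n}. vec_index v i)" by (intro eq_vecI) auto
  have "vec n (\<lambda>i\<in>{..<n}. vec_index v i) \<in> vec n ` ({..<n} \<rightarrow>\<^sub>E UNIV)"
    by (rule imageI) (simp add: PiE_iff extensional_def)
  then show "v \<in> vec n ` ({..<n} \<rightarrow>\<^sub>E UNIV)" by (simp only: eq[symmetric])
qed (elim imageE, simp)

lemma card_carrier_vec: "card (carrier_vec n :: 'a::finite vec set) = CARD('a) ^ n"
proof -
  have "inj_on (vec n) ({..<n} \<rightarrow>\<^sub>E (UNIV :: 'a set))"
  proof (rule inj_onI)
    fix f g :: "nat \<Rightarrow> 'a" assume fg: "f \<in> {..<n} \<rightarrow>\<^sub>E UNIV" "g \<in> {..<n} \<rightarrow>\<^sub>E UNIV" and eq: "vec n f = vec n g"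
    have "f i = g i" if "i < n" for i
      using arg_cong[OF eq, of "\<lambda>v. vec_index v i"] that by simp
    then show "f = g" using fg by (intro PiE_ext[OF fg]) simp
  qed
  then show ?thesis unfolding carrier_vec_eq_image by (simp add: card_image card_PiE)
qed

lemma finite_carrier_vec: "finite (carrier_vec n :: 'a::finite vec set)"
  unfolding carrier_vec_eq_image by (intro finite_imageI finite_PiE) simp_all

text \<open>The image of \<open>A\<close> is its column space, whose dimension is the rank.\<close>

lemma card_mult_vec_image:
  fixes A :: "'a::{field,finite} mat"
  assumes A: "A \<in> carrier_mat m n"
  shows "card ((\<lambda>v. A *\<^sub>v v) ` carrier_vec n) = CARD('a) ^ vec_space.rank m A"
proof -
  interpret vec_space "TYPE('a)" m .
  have cols: "set (cols A) \<subseteq> carrier_vec m" using cols_dim[of A] A by simp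
  have "VectorSpace.subspace class_ring (span (set (cols A))) V"
    by (rule span_is_subspace) (simp add: cols)
  then interpret W: vectorspace class_ring "span_vs (set (cols A))"
    by (rule subspace_is_vs)
  have eq: "span (set (cols A)) = (\<lambda>v. A *\<^sub>v v) ` carrier_vec n"
    unfolding col_space_def[symmetric] col_space_eq[OF A] using A by auto
  have "card (span (set (cols A))) = CARD('a) ^ rank A"
    using W.card_carrier_eq_power_dim finite_carrier_vec[where 'a='a]
    by (simp add: eq rank_def)
  then show ?thesis by (simp only: eq)
qed

text \<open>Rank-nullity by counting: \<open>q ^ n\<close> is at most the size of the image times
  the size of the kernel.\<close>

lemma rank_ge_of_card_kernel:
  fixes A :: "'a::{field,finite} mat"
  assumes A: "A \<in> carrier_mat m n"
    and "card {v \<in> carrier_vec n. A *\<^sub>v v = 0\<^sub>v m} \<le> CARD('a) ^ k"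
  shows "n \<le> vec_space.rank m A + k"
proof -
  let ?N = "{v \<in> carrier_vec n. A *\<^sub>v v = 0\<^sub>v m}"
  have "card (carrier_vec n :: 'a vec set) \<le> card ((\<lambda>v. A *\<^sub>v v) ` carrier_vec n) * card ?N"
  proof (rule card_le_image_times_fibre[where d = "(-)"])
    show "finite (carrier_vec n :: 'a vec set)" by (rule finite_carrier_vec)
    show "finite ?N" by (rule finite_subset[OF Collect_restrict finite_carrier_vec])
    fix v w :: "'a vec" assume v: "v \<in> carrier_vec n" and w: "w \<in> carrier_vec n" and eq: "A *\<^sub>v v = A *\<^sub>v w"
    have "A *\<^sub>v (v - w) = A *\<^sub>v v - A *\<^sub>v w"
      by (rule mult_minus_distrib_mat_vec[OF A v w])
    also have "\<dots> = 0\<^sub>v m" unfolding eq using A by (intro eq_vecI) auto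
    finally show "v - w \<in> ?N" using v w by simp
  next
    fix w :: "'a vec" assume w: "w \<in> carrier_vec n"
    show "inj_on (\<lambda>v. v - w) {v \<in> carrier_vec n. A *\<^sub>v v = A *\<^sub>v w}"
    proof (rule inj_onI)
      fix u v assume uv: "u \<in> {v \<in> carrier_vec n. A *\<^sub>v v = A *\<^sub>v w}" "v \<in> {v \<in> carrier_vec n. A *\<^sub>v v = A *\<^sub>v w}"
        and eq: "u - w = v - w"
      have dims: "dim_vec u = n" "dim_vec v = n" "dim_vec w = n" using uv w by auto
      show "u = v"
      proof (rule eq_vecI)
        fix i assume "i < dim_vec v"
        then show "vec_index u i = vec_index v i"
          using arg_cong[OF eq, of "\<lambda>x. vec_index x i"] dims by simp
      qed (simp add: dims)
    qed
  qed
  also have "\<dots> \<le> CARD('a) ^ vec_space.rank m A * CARD('a) ^ k"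
    unfolding card_mult_vec_image[OF A] using assms(2) by (rule mult_left_mono) simp
  finally have "CARD('a) ^ n \<le> CARD('a) ^ (vec_space.rank m A + k)"
    by (simp only: card_carrier_vec power_add)
  then show ?thesis
    by (rule power_le_imp_le_exp[OF CARD_field_gt_1])
qed

text \<open>The product with a vector depends only on its last \<open>n - k\<close> coordinates,
  which bounds the size of the image.\<close>

lemma rank_le_of_zero_columns:
  fixes A :: "'a::{field,finite} mat"
  assumes A: "A \<in> carrier_mat m n"
    and zero: "\<And>i j. i < m \<Longrightarrow> j < k \<Longrightarrow> A $$ (i, j) = 0" and "k \<le> n"
  shows "vec_space.rank m A \<le> n - k"
proof -
  let ?P = "{k..<n} \<rightarrow>\<^sub>E (UNIV :: 'a set)"
  let ?g = "\<lambda>w. A *\<^sub>v vec n w"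
  have "(\<lambda>v. A *\<^sub>v v) ` carrier_vec n \<subseteq> ?g ` ?P"
  proof (rule image_subsetI)
    fix v :: "'a vec" assume v: "v \<in> carrier_vec n"
    have "A *\<^sub>v v = ?g (\<lambda>i\<in>{k..<n}. vec_index v i)"
    proof (rule eq_vecI)
      fix i assume "i < dim_vec (?g (\<lambda>i\<in>{k..<n}. vec_index v i))"
      then have i: "i < m" using A by simp
      show "vec_index (A *\<^sub>v v) i = vec_index (?g (\<lambda>i\<in>{k..<n}. vec_index v i)) i"
        using A v i zero[OF i] by (auto simp: scalar_prod_def intro!: sum.cong)
    qed simp
    moreover have "?g (\<lambda>i\<in>{k..<n}. vec_index v i) \<in> ?g ` ?P"
      by (rule imageI) (simp add: PiE_iff extensional_def)
    ultimately show "A *\<^sub>v v \<in> ?g ` ?P" by (simp only:)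
  qed
  then have "card ((\<lambda>v. A *\<^sub>v v) ` carrier_vec n) \<le> card (?g ` ?P)"
    by (intro card_mono finite_imageI finite_PiE) simp_all
  also have "\<dots> \<le> card ?P"
    by (intro card_image_le finite_PiE) simp_all
  also have "\<dots> = CARD('a) ^ (n - k)" by (simp add: card_PiE)
  finally have "CARD('a) ^ vec_space.rank m A \<le> CARD('a) ^ (n - k)"
    by (simp only: card_mult_vec_image[OF A])
  then show ?thesis
    by (rule power_le_imp_le_exp[OF CARD_field_gt_1])
qed

section \<open>The arithmetic that places the minimum of the column sums at
  \<open>j = 0\<close>\<close>

text \<open>With \<open>L = l + 1\<close> the left side is the column sum for index 0 and the right
  side the one for \<open>j\<close>. As \<open>x - (x - j) = min x j\<close>, the claim reduces to
  \<open>main\<close>. If \<open>L \<le> m - j\<close> or \<open>j = 1\<close>, bounding both minima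
  by \<open>j\<close> suffices; divisibility is used in the remaining case.\<close>

lemma nu_bound:
  fixes b L m j :: nat
  assumes "b > 0" "b dvd L" "b dvd m" "0 < L" "L < m" "1 \<le> j" "L + j \<le> m + 1"
  shows "(L - b) * b + (b - 1) * L \<le> (L - b) * (b - j) + b * (L - j) + (j - 1) * (m - j)"
proof -
  have bL: "b \<le> L" using assms by (simp add: dvd_imp_le)
  have main: "(L - b) * min b j + b * min L j \<le> L + (j - 1) * (m - j)"
  proof (cases "j = 1 \<or> L \<le> m - j")
    case True
    have "(L - b) * min b j + b * min L j \<le> (L - b) * j + b * j"
      by (intro add_mono mult_left_mono) simp_all
    also have "\<dots> = L * j" using bL by (simp add: add_mult_distrib[symmetric])
    also have "\<dots> = L + (j - 1) * L" using \<open>1 \<le> j\<close> by (cases j) simp_all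
    also have "\<dots> \<le> L + (j - 1) * (m - j)"
      using True by (auto intro: mult_left_mono)
    finally show ?thesis .
  next
    case False
    \<comment> \<open>Only \<open>L + j = m + 1\<close> with \<open>j > 1\<close> is left. Then
      \<open>m - L = j - 1\<close> is a positive multiple of \<open>b\<close>, so
      \<open>b \<le> j - 1\<close>.\<close>
    have "b dvd m - L" using assms(2,3) by (rule dvd_diff_nat[rotated])
    then have "b \<le> m - L" using assms(5) by (intro dvd_imp_le) simp_all
    moreover have mj: "m - j = L - 1" "m - L = j - 1" using False assms by auto
    ultimately have y: "b \<le> j - 1" by simp
    show ?thesis
    proof (cases "L = b")
      case True
      have "b * (b - 1) \<le> (j - 1) * (b - 1)" using y by (rule mult_right_mono) simp
      moreover have "min b j = b" using y by simp
      then have "b * min b j = b + b * (b - 1)" using \<open>b > 0\<close> by (cases b) simp_all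
      ultimately show ?thesis unfolding mj True by simp
    next
      case False
      obtain c where c: "L = b * c" using assms(2) by (rule dvdE)
      have "c \<noteq> 0" "c \<noteq> 1" using c False assms(4) by auto
      then have "2 \<le> c" by simp
      then have "b * 2 \<le> b * c" by (rule mult_left_mono) simp
      then have L: "2 * b \<le> L" using c by simp
      \<comment> \<open>The substitutions for \<open>j\<close>, \<open>L\<close> and
        \<open>b\<close> remove all truncated subtractions before the products are expanded.\<close>
      obtain y where y': "j = b + y + 1" using y assms(6) by (metis add.commute add_diff_inverse_nat le_Suc_ex not_less)
      obtain d where d: "L = 2 * b + d" using L by (metis le_Suc_ex)
      obtain b' where b': "b = Suc b'" using assms(1) by (cases b) auto
      have "(L - b) * min b j + b * min L j \<le> (L - b) * b + b * j"
        by (intro add_mono mult_left_mono) simp_all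
      also have "\<dots> \<le> L + (j - 1) * (L - 1)"
        unfolding y' d b' by (simp add: algebra_simps)
      finally show ?thesis unfolding mj .
    qed
  qed
  have 1: "(L - b) * b = (L - b) * (b - j) + (L - b) * min b j"
    by (simp add: add_mult_distrib2[symmetric] min_def)
  have "b * L = b * (L - j) + b * min L j"
    by (simp add: add_mult_distrib2[symmetric] min_def)
  moreover have "(b - 1) * L + L = b * L" using assms(1) by (cases b) simp_all
  ultimately show ?thesis using main 1 by linarith
qed

section \<open>Evaluation codes\<close>

lemma fq_basis_segment:
  assumes "fq_basis m e S" "n \<le> m"
  shows "fq_basis n e (range (comb n e))"
proof (rule fq_basisI)
  show "\<forall>i<n. v i = 0" if "comb n e v = 0" for v
    using fq_basis_segment_independent[OF assms that] by simp
qed auto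

text \<open>When an initial segment of a basis spans \<open>T\<close>, membership in
  \<open>T\<close> kills all later coordinates. This is how conditions on values become zero entries
  below a column height.\<close>

lemma fq_basis_segment_coords:
  assumes "fq_basis m e S" "fq_basis k e T" "k \<le> m" "comb m e v \<in> T" "k \<le> i" "i < m"
  shows "v i = 0"
proof -
  obtain w where "comb m e v = comb k e w" by (rule fq_basis_coords[OF assms(2,4)])
  also have "comb k e w = comb m e (\<lambda>i. if i < k then w i else 0)"
    by (rule comb_extend_zero[OF assms(3)])
  finally have "v i = (if i < k then w i else 0)"
    by (rule fq_basis_inj[OF assms(1) _ assms(6)])
  then show ?thesis using assms(5) by simp
qed

text \<open>Basis extension applied from 0 to \<open>R\<close>, then to \<open>S\<close>, then to
  \<open>T\<close>; each step keeps the earlier vectors.\<close>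

lemma fq_basis_flag:
  fixes R S T :: "'a::{field,finite} alg_closure set"
  assumes R: "stable_subgroup (range to_ac) R" "card R = CARD('a) ^ i"
    and S: "stable_subgroup (range to_ac) S" "card S = CARD('a) ^ j"
    and T: "stable_subgroup (range to_ac) T" "card T = CARD('a) ^ k"
    and sub: "R \<subseteq> S" "S \<subseteq> T" and le: "i \<le> j" "j \<le> k"
  obtains e where "fq_basis i e R" "fq_basis j e S" "fq_basis k e T"
proof -
  have 0: "{0} \<subseteq> R" using stable_subgroupD(1)[OF R(1)] by simp
  obtain e1 where e1: "fq_basis (0 + i) e1 R"
    by (rule fq_basis_extend[OF fq_basis_0 stable_subgroup_zero R(1) 0, of i]) (simp_all add: R(2))
  then have e1: "fq_basis i e1 R" by simp
  have card: "card S = CARD('a) ^ (i + (j - i))" "card T = CARD('a) ^ (j + (k - j))"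
    using S(2) T(2) le by simp_all
  obtain e2 where e2: "\<forall>t<i. e2 t = e1 t" "fq_basis (i + (j - i)) e2 S"
    by (rule fq_basis_extend[OF e1 R(1) S(1) sub(1) card(1)])
  have e2S: "fq_basis j e2 S" using e2(2) le by simp
  obtain e3 where e3: "\<forall>t<j. e3 t = e2 t" "fq_basis (j + (k - j)) e3 T"
    by (rule fq_basis_extend[OF e2S S(1) T(1) sub(2) card(2)])
  have "fq_basis j e3 S" using fq_basis_cong[of j e3 e2 S] e3(1) e2S by simp
  moreover have "fq_basis i e3 R" using fq_basis_cong[of i e3 e1 R] e3(1) e2(1) le e1 by simp
  moreover have "fq_basis k e3 T" using e3(2) le by simp
  ultimately show ?thesis by (intro that)
qed

text \<open>The points \<open>e\<close> are adapted to the flag of \<open>E'\<close>,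
  \<open>E\<close> and \<open>GF m\<close>, the expansion basis \<open>\<omega>\<close> to the flag
  of \<open>GF b\<close>, \<open>V\<close> and \<open>GF m\<close>.\<close>

lemma (in prime_power_field) exists_evaluation_bases:
  assumes b: "b > 0" "b dvd m" "b dvd l + 1" and l: "l > 0" "l + 1 \<le> m"
  obtains e \<omega> V where
    "fq_basis m e (GF m :: 'a alg_closure set)" "fq_basis m \<omega> (GF m :: 'a alg_closure set)"
    "fq_basis b \<omega> (GF b)" "fq_basis (l + 1) \<omega> V" "V \<subseteq> GF m"
    "CARD('a) ^ ((l + 1 - b) * b + (l + 1) * b) \<le> CARD('a) ^ (l + 1) *
      card {f \<in> {..<l} \<rightarrow>\<^sub>E GF m. \<forall>i<l + 1. qpoly l f (e i) \<in> (if i < l + 1 - b then GF b else V)}"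
proof -
  have m: "m > 0" using l by simp
  have bl: "b \<le> l + 1" using b(3) by (rule dvd_imp_le) simp
  have lt: "l + 1 - b < m" using b(1) l(2) by simp
  obtain s where s: "l + 1 = b * s" using b(3) by (rule dvdE)
  \<comment> \<open>\<open>E'\<close> receives one \<open>GF b\<close>-dimension less than the
    \<open>s\<close> dimensions of \<open>E\<close>.\<close>
  have bs: "b * (s - 1) = l + 1 - b" unfolding s by (simp add: diff_mult_distrib2)
  have "b * (s - 1) \<le> m" unfolding bs using lt by simp
  from stable_subgroup_exists[OF b(1,2) m this] obtain E' :: "'a alg_closure set"
    where E': "E' \<subseteq> GF m" "stable_subgroup (GF b) E'" "card E' = CARD('a) ^ (l + 1 - b)"
    unfolding bs by auto
  from stable_subgroup_chain[OF b(1,2) m E'(2,1,3) lt] obtain E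
    where E: "E' \<subseteq> E" "E \<subseteq> GF m" "stable_subgroup (GF b) E" "card E = CARD('a) ^ (l + 1)"
    using bl by auto
  have K: "stable_subgroup (range to_ac) (GF m :: 'a alg_closure set)"
      "card (GF m :: 'a alg_closure set) = CARD('a) ^ m"
    using stable_subgroup_to_ac[OF stable_subgroup_GF[OF b(2)]] card_GF[OF m] by simp_all
  obtain e where e: "fq_basis (l + 1 - b) e E'" "fq_basis (l + 1) e E" "fq_basis m e (GF m)"
    by (rule fq_basis_flag[OF stable_subgroup_to_ac[OF E'(2)] E'(3)
      stable_subgroup_to_ac[OF E(3)] E(4) K E(1,2) _ l(2)]) simp_all
  interpret ev: evaluation_basis ty b l m e E' E
    by unfold_locales (use b(1,2) bl l m e E' E in simp_all)
  obtain V where V: "stable_subgroup (GF b) V" "GF b \<subseteq> V" "V \<subseteq> GF m" "card V = CARD('a) ^ (l + 1)"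
    "CARD('a) ^ ((l + 1 - b) * b + (l + 1) * b) \<le> CARD('a) ^ (l + 1) *
      card {f \<in> {..<l} \<rightarrow>\<^sub>E GF m. \<forall>i<l + 1. qpoly l f (e i) \<in> (if i < l + 1 - b then GF b else V)}"
    by (rule ev.exists_scaled_leading)
  obtain \<omega> where "fq_basis b \<omega> (GF b :: 'a alg_closure set)" "fq_basis (l + 1) \<omega> V" "fq_basis m \<omega> (GF m)"
    by (rule fq_basis_flag[OF stable_subgroup_to_ac[OF stable_subgroup_GF[OF dvd_refl]] card_GF[OF b(1)]
      stable_subgroup_to_ac[OF V(1)] V(4) K V(2,3) bl l(2)])
  with e(3) V(3,5) show ?thesis by (intro that)
qed

section \<open>The evaluation code of a shape \<open>F\<close> and its size\<close>

locale evaluation_code = prime_power_field ty for ty :: "'a::{field,finite} itself" +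
  fixes m n l :: nat and e \<omega> :: "nat \<Rightarrow> 'a alg_closure" and F :: "(nat \<times> nat) set"
  assumes e: "fq_basis m e (GF m)" and \<omega>: "fq_basis m \<omega> (GF m)"
    and l: "0 < l" "l \<le> n" and n: "n \<le> m"
begin

text \<open>Column \<open>j\<close> lists the coordinates in \<open>\<omega>\<close> of the value at
  \<open>e j\<close>. The existential over \<open>f\<close> makes linearity immediate; the
  coefficients below \<open>l\<close> are determined by the first \<open>l\<close> columns.\<close>

definition code :: "'a mat set" where
  "code = {A \<in> carrier_mat m n.
    (\<exists>f. \<forall>j<n. qpoly l f (e j) = comb m \<omega> (\<lambda>i. A $$ (i, j))) \<and>
    (\<forall>i<m. \<forall>j<n. A $$ (i, j) \<noteq> 0 \<longrightarrow> (Suc i, Suc j) \<in> F)}"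

lemma codeD:
  assumes "A \<in> code"
  shows "A \<in> carrier_mat m n"
    and "\<exists>f. \<forall>j<n. qpoly l f (e j) = comb m \<omega> (\<lambda>i. A $$ (i, j))"
    and "i < m \<Longrightarrow> j < n \<Longrightarrow> A $$ (i, j) \<noteq> 0 \<Longrightarrow> (Suc i, Suc j) \<in> F"
  using assms unfolding code_def by simp_all

lemma codeI:
  assumes "A \<in> carrier_mat m n"
    and "\<And>j. j < n \<Longrightarrow> qpoly l f (e j) = comb m \<omega> (\<lambda>i. A $$ (i, j))"
    and "\<And>i j. i < m \<Longrightarrow> j < n \<Longrightarrow> A $$ (i, j) \<noteq> 0 \<Longrightarrow> (Suc i, Suc j) \<in> F"
  shows "A \<in> code"
  unfolding code_def mem_Collect_eq using assms by (intro conjI exI[of _ f]) simp_all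

lemma zero_in_code: "0\<^sub>m m n \<in> code"
proof (rule codeI[where f = "\<lambda>_. 0"])
  fix j assume "j < n"
  then have "comb m \<omega> (\<lambda>i. 0\<^sub>m m n $$ (i, j)) = comb m \<omega> (\<lambda>_. 0)"
    by (intro comb_cong) simp_all
  then show "qpoly l (\<lambda>_. 0) (e j) = comb m \<omega> (\<lambda>i. 0\<^sub>m m n $$ (i, j))"
    by (simp add: qpoly_def comb_def)
qed simp_all

lemma add_in_code:
  assumes A: "A \<in> code" and B: "B \<in> code"
  shows "A + B \<in> code"
proof -
  note c = codeD(1)[OF A] codeD(1)[OF B]
  obtain f where f: "\<forall>j<n. qpoly l f (e j) = comb m \<omega> (\<lambda>i. A $$ (i, j))"
    using codeD(2)[OF A] by (rule exE)
  obtain g where g: "\<forall>j<n. qpoly l g (e j) = comb m \<omega> (\<lambda>i. B $$ (i, j))"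
    using codeD(2)[OF B] by (rule exE)
  show ?thesis
  proof (rule codeI[where f = "\<lambda>j. f j + g j"])
    fix j assume j: "j < n"
    have "comb m \<omega> (\<lambda>i. (A + B) $$ (i, j)) = comb m \<omega> (\<lambda>i. A $$ (i, j) + B $$ (i, j))"
      using c j by (intro comb_cong) auto
    then show "qpoly l (\<lambda>j. f j + g j) (e j) = comb m \<omega> (\<lambda>i. (A + B) $$ (i, j))"
      using f g j by (simp add: qpoly_add comb_add)
  next
    fix i j assume ij: "i < m" "j < n" "(A + B) $$ (i, j) \<noteq> 0"
    then have "A $$ (i, j) \<noteq> 0 \<or> B $$ (i, j) \<noteq> 0" using c by auto
    then show "(Suc i, Suc j) \<in> F" using codeD(3)[OF A ij(1,2)] codeD(3)[OF B ij(1,2)] by auto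
  qed (use c in simp)
qed

lemma smult_in_code:
  assumes A: "A \<in> code"
  shows "c \<cdot>\<^sub>m A \<in> code"
proof -
  note cA = codeD(1)[OF A]
  obtain f where f: "\<forall>j<n. qpoly l f (e j) = comb m \<omega> (\<lambda>i. A $$ (i, j))"
    using codeD(2)[OF A] by (rule exE)
  show ?thesis
  proof (rule codeI[where f = "\<lambda>j. to_ac c * f j"])
    fix j assume j: "j < n"
    have "comb m \<omega> (\<lambda>i. (c \<cdot>\<^sub>m A) $$ (i, j)) = comb m \<omega> (\<lambda>i. c * A $$ (i, j))"
      using cA j by (intro comb_cong) auto
    then show "qpoly l (\<lambda>j. to_ac c * f j) (e j) = comb m \<omega> (\<lambda>i. (c \<cdot>\<^sub>m A) $$ (i, j))"
      using f j by (simp add: qpoly_scale comb_scale)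
  next
    fix i j assume ij: "i < m" "j < n" "(c \<cdot>\<^sub>m A) $$ (i, j) \<noteq> 0"
    then have "A $$ (i, j) \<noteq> 0" using cA by auto
    then show "(Suc i, Suc j) \<in> F" using codeD(3)[OF A ij(1,2)] by simp
  qed (use cA in simp)
qed

lemma subspace_code: "VectorSpace.subspace class_ring code (mat_space TYPE('a) m n)"
proof -
  interpret V: vectorspace class_ring "mat_space TYPE('a) m n"
    by (rule vectorspace_mat_space)
  have "submodule class_ring code (mat_space TYPE('a) m n)"
  proof (rule submodule.intro)
    show "Module.module class_ring (mat_space TYPE('a) m n)" by (rule V.module_axioms)
    show "code \<subseteq> carrier (mat_space TYPE('a) m n)"
      using codeD(1) by (auto simp: mat_space_def)
  qed (simp_all add: mat_space_def add_in_code zero_in_code smult_in_code)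
  then show ?thesis
    unfolding VectorSpace.subspace_def using V.vectorspace_axioms by simp
qed

lemma code_entries_eq_0:
  assumes A: "A \<in> code" and f: "\<forall>j<n. qpoly l f (e j) = comb m \<omega> (\<lambda>i. A $$ (i, j))"
    and "\<And>k. k < l \<Longrightarrow> f k = 0"
  shows "A = 0\<^sub>m m n"
proof (rule eq_matI)
  fix i j assume "i < dim_row (0\<^sub>m m n :: 'a mat)" "j < dim_col (0\<^sub>m m n :: 'a mat)"
  then have ij: "i < m" "j < n" by simp_all
  have "qpoly l f (e j) = 0" using assms(3) by (simp add: qpoly_def)
  then have "comb m \<omega> (\<lambda>i. A $$ (i, j)) = 0" using f ij(2) by simp
  then show "A $$ (i, j) = 0\<^sub>m m n $$ (i, j)"
    using fq_basis_independent[OF \<omega> _ ij(1)] ij by simp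
qed (use codeD(1)[OF A] in auto)

text \<open>A polynomial with \<open>l\<close> coefficients vanishing at \<open>l\<close>
  independent points is zero.\<close>

lemma code_eq_0:
  assumes A: "A \<in> code" and zero: "\<And>i j. i < m \<Longrightarrow> j < l \<Longrightarrow> A $$ (i, j) = 0"
  shows "A = 0\<^sub>m m n"
proof -
  obtain f where f: "\<forall>j<n. qpoly l f (e j) = comb m \<omega> (\<lambda>i. A $$ (i, j))"
    using codeD(2)[OF A] by (rule exE)
  have "f k = 0" if "k < l" for k
  proof -
    have "qpoly l f (e j) = qpoly l (\<lambda>_. 0) (e j)" if "j < l" for j
    proof -
      have "comb m \<omega> (\<lambda>i. A $$ (i, j)) = comb m \<omega> (\<lambda>_. 0)"
        using zero that by (intro comb_cong) simp_all
      then show ?thesis using f that l by (simp add: comb_def qpoly_def)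
    qed
    moreover have "fq_basis l e (range (comb l e))"
      using l n by (intro fq_basis_segment[OF e]) simp
    ultimately show ?thesis using qpoly_eqI[OF _ order_refl] that by metis
  qed
  then show ?thesis by (rule code_entries_eq_0[OF A f])
qed

text \<open>Vectors in the kernel of a code matrix correspond to roots of its \<^const>\<open>qpoly\<close>.\<close>

lemma code_rank_ge:
  assumes A: "A \<in> code" and "A \<noteq> 0\<^sub>m m n"
  shows "n \<le> vec_space.rank m A + (l - 1)"
proof (rule rank_ge_of_card_kernel[OF codeD(1)[OF A]])
  obtain f where f: "\<forall>j<n. qpoly l f (e j) = comb m \<omega> (\<lambda>i. A $$ (i, j))"
    using codeD(2)[OF A] by (rule exE)
  let ?N = "{v \<in> carrier_vec n. A *\<^sub>v v = 0\<^sub>v m}"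
  let ?R = "(\<lambda>v. comb n e (vec_index v)) ` ?N"
  have inj: "inj_on (\<lambda>v. comb n e (vec_index v)) ?N"
  proof (rule inj_onI)
    fix v w :: "'a vec" assume vw: "v \<in> ?N" "w \<in> ?N"
      and eq: "comb n e (vec_index v) = comb n e (vec_index w)"
    have dims: "dim_vec v = n" "dim_vec w = n" using vw by auto
    show "v = w"
    proof (rule eq_vecI)
      fix i assume "i < dim_vec w"
      then show "vec_index v i = vec_index w i"
        using fq_basis_inj[OF fq_basis_segment[OF e n] eq] dims by simp
    qed (simp add: dims)
  qed
  have root: "qpoly l f x = 0" if x: "x \<in> ?R" for x
  proof -
    obtain v where v: "x = comb n e (vec_index v)" "v \<in> ?N" using x by (rule imageE)
    have cv: "A \<in> carrier_mat m n" "v \<in> carrier_vec n" "A *\<^sub>v v = 0\<^sub>v m" using v codeD(1)[OF A] by simp_all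
    have row: "(\<Sum>j<n. vec_index v j * A $$ (i, j)) = 0" if "i < m" for i
    proof -
      have "vec_index (A *\<^sub>v v) i = (\<Sum>j<n. vec_index v j * A $$ (i, j))"
        using cv(1,2) that by (auto simp: scalar_prod_def mult.commute lessThan_atLeast0 intro!: sum.cong)
      then show ?thesis using cv(3) that by simp
    qed
    have "qpoly l f x = (\<Sum>j<n. to_ac (vec_index v j) * comb m \<omega> (\<lambda>i. A $$ (i, j)))"
      unfolding v(1) qpoly_comb using f by (intro sum.cong) simp_all
    also have "\<dots> = (\<Sum>j<n. \<Sum>i<m. to_ac (vec_index v j * A $$ (i, j)) * \<omega> i)"
      by (simp add: comb_def sum_distrib_left mult.assoc)
    \<comment> \<open>After the exchange of sums the coefficient of each \<open>\<omega> i\<close>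
      is an entry of \<open>A\<close> times \<open>v\<close>, which is 0.\<close>
    also have "\<dots> = (\<Sum>i<m. \<Sum>j<n. to_ac (vec_index v j * A $$ (i, j)) * \<omega> i)"
      by (rule sum.swap)
    also have "\<dots> = (\<Sum>i<m. to_ac (\<Sum>j<n. vec_index v j * A $$ (i, j)) * \<omega> i)"
      by (simp only: to_ac_sum sum_distrib_right)
    also have "\<dots> = 0" using row by (intro sum.neutral) simp
    finally show ?thesis .
  qed
  have "card ?R \<le> CARD('a) ^ (l - 1)"
  proof (rule ccontr)
    assume "\<not> card ?R \<le> CARD('a) ^ (l - 1)"
    then have "CARD('a) ^ (l - 1) < card ?R" by simp
    from qpoly_coeffs_eq_0[OF root this] have "f k = 0" if "k < l" for k using that by simp
    then have "A = 0\<^sub>m m n" by (rule code_entries_eq_0[OF A f])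
    with \<open>A \<noteq> 0\<^sub>m m n\<close> show False ..
  qed
  then show "card ?N \<le> CARD('a) ^ (l - 1)"
    by (simp only: card_image[OF inj])
qed

definition positions :: "(nat \<times> nat) set" where
  "positions = {(i, j). i < m \<and> j < l \<and> (Suc i, Suc j) \<in> F}"

definition entries :: "'a mat \<Rightarrow> nat \<times> nat \<Rightarrow> 'a" where
  "entries A = (\<lambda>p\<in>positions. A $$ p)"

lemma finite_positions: "finite positions"
proof (rule finite_subset)
  show "positions \<subseteq> {..<m} \<times> {..<l}" by (auto simp: positions_def)
qed simp

text \<open>The difference of two codewords with equal entries is a codeword vanishing on the first
  \<open>l\<close> columns: inside \<open>F\<close> by assumption, outside \<open>F\<close> because
  both entries are 0.\<close>

lemma inj_on_entries: "inj_on entries code"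
proof (rule inj_onI)
  fix A B assume A: "A \<in> code" and B: "B \<in> code" and eq: "entries A = entries B"
  note c = codeD(1)[OF A] codeD(1)[OF B]
  let ?D = "A + (- 1) \<cdot>\<^sub>m B"
  have "?D \<in> code" by (intro add_in_code A smult_in_code B)
  moreover have "?D $$ (i, j) = 0" if ij: "i < m" "j < l" for i j
  proof -
    have jn: "j < n" using ij l by simp
    have "A $$ (i, j) = B $$ (i, j)"
    proof (cases "(i, j) \<in> positions")
      case True
      then show ?thesis using fun_cong[OF eq, of "(i, j)"] by (simp add: entries_def)
    next
      case False
      then have "(Suc i, Suc j) \<notin> F" using ij by (simp add: positions_def)
      then show ?thesis using codeD(3)[OF A ij(1) jn] codeD(3)[OF B ij(1) jn] by metis
    qed
    then show ?thesis using c ij(1) jn by simp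
  qed
  ultimately have D: "?D = 0\<^sub>m m n" by (rule code_eq_0)
  show "A = B"
  proof (rule eq_matI)
    fix i j assume "i < dim_row B" "j < dim_col B"
    then have "i < m" "j < n" using c by auto
    then show "A $$ (i, j) = B $$ (i, j)"
      using arg_cong[OF D, of "\<lambda>M. M $$ (i, j)"] c by simp
  qed (use c in auto)
qed

lemma entries_code_subset: "entries ` code \<subseteq> positions \<rightarrow>\<^sub>E UNIV"
  by (rule image_subsetI) (simp add: entries_def)

lemma finite_code: "finite code"
proof (rule finite_imageD[OF _ inj_on_entries])
  show "finite (entries ` code)"
    by (rule finite_subset[OF entries_code_subset]) (intro finite_PiE finite_positions finite)
qed

text \<open>Each polynomial in \<open>N\<close> is expanded into a codeword; its values at the first
  \<open>l\<close> points recover its coefficients.\<close>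

lemma card_code_ge:
  assumes N: "N \<subseteq> {..<l} \<rightarrow>\<^sub>E UNIV"
    and val: "\<And>f j. f \<in> N \<Longrightarrow> j < n \<Longrightarrow> qpoly l f (e j) \<in> GF m"
    and supp: "\<And>f i j v. f \<in> N \<Longrightarrow> i < m \<Longrightarrow> j < n \<Longrightarrow> qpoly l f (e j) = comb m \<omega> v \<Longrightarrow> v i \<noteq> 0 \<Longrightarrow> (Suc i, Suc j) \<in> F"
  shows "card N \<le> card code"
proof -
  \<comment> \<open>A choice of coordinates, meaningful on \<open>GF m\<close> only, which
    \<open>val\<close> guarantees for the values in question.\<close>
  define c where "c x = (SOME v. x = comb m \<omega> v)" for x
  have c: "comb m \<omega> (c x) = x" if x: "x \<in> GF m" for x
  proof -
    obtain v where "x = comb m \<omega> v" by (rule fq_basis_coords[OF \<omega> x])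
    then have "x = comb m \<omega> (c x)" unfolding c_def by (rule someI[of "\<lambda>v. x = comb m \<omega> v"])
    then show ?thesis by (rule sym)
  qed
  define M where "M f = mat m n (\<lambda>(i, j). c (qpoly l f (e j)) i)" for f
  have M: "comb m \<omega> (\<lambda>i. M f $$ (i, j)) = qpoly l f (e j)" if "f \<in> N" "j < n" for f j
  proof -
    have "comb m \<omega> (\<lambda>i. M f $$ (i, j)) = comb m \<omega> (c (qpoly l f (e j)))"
      using that by (intro comb_cong) (simp_all add: M_def)
    then show ?thesis by (simp only: c[OF val[OF that]])
  qed
  show ?thesis
  proof (rule card_inj_on_le[OF _ _ finite_code])
    show "inj_on M N"
    proof (rule inj_onI)
      fix f g assume f: "f \<in> N" and g: "g \<in> N" and eq: "M f = M g"
      have v: "qpoly l f (e j) = qpoly l g (e j)" if "j < l" for j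
        using M[OF f, of j] M[OF g, of j] eq that l by simp
      have "f k = g k" if "k < l" for k
        by (rule qpoly_eqI[OF fq_basis_segment[OF e, of l] order_refl v that]) (use l n in simp)
      then show "f = g"
        using subsetD[OF N f] subsetD[OF N g] by (intro PiE_ext[of f "{..<l}" "\<lambda>_. UNIV" g]) simp_all
    qed
    show "M ` N \<subseteq> code"
    proof (rule image_subsetI)
      fix f assume f: "f \<in> N"
      show "M f \<in> code"
      proof (rule codeI[where f = f])
        show "M f \<in> carrier_mat m n" by (simp add: M_def)
        show "qpoly l f (e j) = comb m \<omega> (\<lambda>i. M f $$ (i, j))" if "j < n" for j
          by (rule M[OF f that, symmetric])
        fix i j assume "i < m" "j < n" "M f $$ (i, j) \<noteq> 0"
        then show "(Suc i, Suc j) \<in> F"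
          by (intro supp[OF f _ _ M[OF f, symmetric]])
      qed
    qed
  qed
qed

text \<open>The lower bound makes the injective map \<open>entries\<close> onto, so the first
  \<open>l\<close> columns can be prescribed freely within \<open>F\<close>. Prescribing one nonzero
  entry, in column \<open>l\<close>, leaves \<open>l - 1\<close> zero columns and bounds the
  rank.\<close>

lemma full_code:
  assumes ge: "CARD('a) ^ card positions \<le> card code"
    and top: "(1, l) \<in> F"
  shows "card code = CARD('a) ^ card positions"
    and "\<exists>A\<in>code - {0\<^sub>m m n}. vec_space.rank m A \<le> n - (l - 1)"
proof -
  let ?P = "positions \<rightarrow>\<^sub>E (UNIV :: 'a set)"
  have cardP: "card ?P = CARD('a) ^ card positions"
    by (simp add: card_PiE finite_positions)
  have fin: "finite ?P" by (intro finite_PiE finite_positions finite)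
  have im: "card (entries ` code) = card code" by (rule card_image[OF inj_on_entries])
  have "card (entries ` code) \<le> card ?P" by (rule card_mono[OF fin entries_code_subset])
  then show card: "card code = CARD('a) ^ card positions" using im cardP ge by simp
  have surj: "entries ` code = ?P"
    by (rule card_subset_eq[OF fin entries_code_subset]) (simp only: im cardP card)
  \<comment> \<open>Matrix indices start at 0, so this is the cell \<open>(1, l)\<close> of
    \<open>F\<close>.\<close>
  have pos: "(0, l - 1) \<in> positions" using top l n by (simp add: positions_def)
  let ?t = "\<lambda>p\<in>positions. if p = (0, l - 1) then 1 else (0 :: 'a)"
  have "?t \<in> ?P" by simp
  then have "?t \<in> entries ` code" by (simp only: surj)
  then obtain A where A: "?t = entries A" "A \<in> code" by (rule imageE)
  have "A $$ (0, l - 1) = 1"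
    using fun_cong[OF A(1), of "(0, l - 1)"] pos by (simp add: entries_def)
  then have "A \<noteq> 0\<^sub>m m n" using l n by auto
  moreover have "vec_space.rank m A \<le> n - (l - 1)"
  proof (rule rank_le_of_zero_columns[OF codeD(1)[OF A(2)]])
    fix i j assume ij: "i < m" "j < l - 1"
    show "A $$ (i, j) = 0"
    proof (cases "(i, j) \<in> positions")
      case True
      then show ?thesis using fun_cong[OF A(1), of "(i, j)"] ij by (simp add: entries_def)
    next
      case False
      then have "(Suc i, Suc j) \<notin> F" using ij by (simp add: positions_def)
      moreover have "j < n" using ij(2) l(2) by simp
      ultimately show ?thesis using codeD(3)[OF A(2) ij(1), of j] by metis
    qed
  qed (use l in simp)
  ultimately show "\<exists>A\<in>code - {0\<^sub>m m n}. vec_space.rank m A \<le> n - (l - 1)"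
    using A(2) by (intro bexI[of _ A]) simp_all
qed

end

section \<open>Column sums\<close>

definition column_list :: "nat \<Rightarrow> nat \<Rightarrow> nat \<Rightarrow> nat \<Rightarrow> nat list" where
  "column_list b L d m = replicate (L - b) b @ replicate b L @ replicate d m"

lemma length_column_list: "b \<le> L \<Longrightarrow> length (column_list b L d m) = L + d"
  by (simp add: column_list_def)

lemma nth_column_list:
  assumes "b \<le> L" "t < L + d"
  shows "column_list b L d m ! t = (if t < L - b then b else if t < L then L else m)"
proof -
  have "t - (L - b) < b \<longleftrightarrow> t < L" if "\<not> t < L - b" using that assms(1) by linarith
  moreover have "t - (L - b) - b < d" if "\<not> t < L" using that assms by linarith
  ultimately show ?thesis by (simp add: column_list_def nth_append)
qed

lemma sum_nth_take:
  fixes f :: "nat \<Rightarrow> nat"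
  assumes "k \<le> length xs"
  shows "(\<Sum>t<k. f (xs ! t)) = sum_list (map f (take k xs))"
  using assms by (simp add: sum_list_sum_nth atLeast0LessThan min_def)

text \<open>The first \<open>l\<close> columns stop one short of the block of height
  \<open>l + 1\<close>, hence the factor \<open>b - 1\<close>.\<close>

lemma sum_column_list_0:
  assumes "0 < b" "b \<le> l + 1"
  shows "(\<Sum>t<l. column_list b (l + 1) d m ! t) = (l + 1 - b) * b + (b - 1) * (l + 1)"
proof -
  have l: "l = (l + 1 - b) + (b - 1)" using assms by simp
  have "take ((l + 1 - b) + (b - 1)) (column_list b (l + 1) d m)
      = replicate (l + 1 - b) b @ replicate (b - 1) (l + 1)"
    by (simp add: column_list_def min_def)
  then have "take l (column_list b (l + 1) d m) = replicate (l + 1 - b) b @ replicate (b - 1) (l + 1)"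
    using l by argo
  then show ?thesis
    using sum_nth_take[of l "column_list b (l + 1) d m" "\<lambda>x. x"] assms
    by (simp add: length_column_list sum_list_replicate)
qed

text \<open>For \<open>j \<ge> 1\<close> the first \<open>l + j\<close> columns contain the whole
  block of height \<open>l + 1\<close> and \<open>j - 1\<close> columns of height
  \<open>m\<close>.\<close>

lemma sum_column_list:
  assumes "b \<le> l + 1" "1 \<le> j" "j \<le> d + 1"
  shows "(\<Sum>t<l + j. column_list b (l + 1) d m ! t - j)
    = (l + 1 - b) * (b - j) + b * (l + 1 - j) + (j - 1) * (m - j)"
proof -
  have "j - 1 \<le> d" using assms(3) by simp
  have lj: "l + j = (l + 1 - b) + (b + (j - 1))" using assms by simp
  have "take ((l + 1 - b) + (b + (j - 1))) (column_list b (l + 1) d m)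
      = replicate (l + 1 - b) b @ replicate b (l + 1) @ replicate (j - 1) m"
    using \<open>j - 1 \<le> d\<close> by (simp add: column_list_def)
  then have "take (l + j) (column_list b (l + 1) d m)
      = replicate (l + 1 - b) b @ replicate b (l + 1) @ replicate (j - 1) m"
    using lj by argo
  then show ?thesis
    using sum_nth_take[of "l + j" "column_list b (l + 1) d m" "\<lambda>x. x - j"] assms
    by (simp add: length_column_list sum_list_replicate)
qed

lemma ferrers_nu_ferrers_of_columns:
  assumes "n - \<delta> + 1 + j \<le> length cs"
  shows "ferrers_nu n (ferrers_of_columns cs) \<delta> j = (\<Sum>t<n - \<delta> + 1 + j. cs ! t - j)"
proof -
  have "ferrers_nu n (ferrers_of_columns cs) \<delta> j
      = (\<Sum>t<n - \<delta> + 1 + j. column_height (ferrers_of_columns cs) (Suc t) - j)"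
    unfolding ferrers_nu_def by (simp only: One_nat_def sum.atLeast1_atMost_eq)
  also have "\<dots> = (\<Sum>t<n - \<delta> + 1 + j. cs ! t - j)"
    using assms by (intro sum.cong refl) (simp add: column_height_ferrers_of_columns)
  finally show ?thesis .
qed

lemma mem_ferrers_of_columns_Suc:
  "(Suc i, Suc j) \<in> ferrers_of_columns cs \<longleftrightarrow> j < length cs \<and> i < cs ! j"
  by (auto simp: ferrers_of_columns_def)

lemma ferrers_diagram_ferrers_of_columns:
  assumes "length cs = n" and le: "\<And>t. t < n \<Longrightarrow> cs ! t \<le> m"
    and mono: "\<And>t. Suc t < n \<Longrightarrow> cs ! t \<le> cs ! Suc t"
  shows "ferrers_diagram m n (ferrers_of_columns cs)"
  unfolding ferrers_diagram_def
proof (intro conjI allI impI)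
  show "ferrers_of_columns cs \<subseteq> {1..m} \<times> {1..n}"
  proof
    fix p assume "p \<in> ferrers_of_columns cs"
    then obtain i j where p: "p = (i, j)" "1 \<le> j" "j \<le> n" "1 \<le> i" "i \<le> cs ! (j - 1)"
      using assms(1) unfolding ferrers_of_columns_def by auto
    moreover have "cs ! (j - 1) \<le> m" using p by (intro le) simp
    ultimately show "p \<in> {1..m} \<times> {1..n}" by simp
  qed
next
  fix i j assume "(i, j) \<in> ferrers_of_columns cs \<and> j < n"
  then have ij: "1 \<le> j" "j < n" "1 \<le> i" "i \<le> cs ! (j - 1)"
    unfolding ferrers_of_columns_def by auto
  then have "cs ! (j - 1) \<le> cs ! j" using mono[of "j - 1"] by simp
  then show "(i, j + 1) \<in> ferrers_of_columns cs"
    using ij assms(1) unfolding ferrers_of_columns_def by simp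
next
  fix i j assume "(i, j) \<in> ferrers_of_columns cs \<and> 1 < i"
  then show "(i - 1, j) \<in> ferrers_of_columns cs"
    unfolding ferrers_of_columns_def by auto
qed

text \<open>The minimum is attained at \<open>j = 0\<close>, where it counts the cells of the first
  \<open>l\<close> columns.\<close>

lemma ferrers_nu_min_eq:
  assumes "b > 0" "b dvd m" "b dvd l + 1" and l: "l = n - \<delta> + 1" and "3 \<le> \<delta>" "\<delta> \<le> n" "n \<le> m"
  shows "ferrers_nu_min n (ferrers_of_columns (column_list b (l + 1) (\<delta> - 2) m)) \<delta>
    = (l + 1 - b) * b + (b - 1) * (l + 1)" (is "ferrers_nu_min n ?F \<delta> = ?v")
proof -
  have bl: "b \<le> l + 1" using assms(3) by (rule dvd_imp_le) simp
  have nu: "ferrers_nu n ?F \<delta> j = (\<Sum>t<l + j. column_list b (l + 1) (\<delta> - 2) m ! t - j)"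
    if "j \<le> \<delta> - 1" for j
    unfolding l by (rule ferrers_nu_ferrers_of_columns)
      (use that bl assms(5,6) l in \<open>simp add: length_column_list\<close>)
  have nu0: "ferrers_nu n ?F \<delta> 0 = ?v"
    using nu[of 0] sum_column_list_0[OF assms(1) bl] by simp
  show ?thesis
    unfolding ferrers_nu_min_def
  proof (rule Min_eqI)
    fix y assume "y \<in> ferrers_nu n ?F \<delta> ` {0..\<delta> - 1}"
    then obtain j where j: "y = ferrers_nu n ?F \<delta> j" "j \<in> {0..\<delta> - 1}" by (rule imageE)
    show "?v \<le> y"
    proof (cases "j = 0")
      case True
      then show ?thesis using j nu0 by simp
    next
      case False
      have "y = (\<Sum>t<l + j. column_list b (l + 1) (\<delta> - 2) m ! t - j)"
        using j nu by simp
      also have "\<dots> = (l + 1 - b) * (b - j) + b * (l + 1 - j) + (j - 1) * (m - j)"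
        using False j(2) assms(5) by (intro sum_column_list bl) auto
      \<comment> \<open>Here \<open>L = l + 1 = n - \<delta> + 2\<close>: from
        \<open>\<delta> \<ge> 3\<close> it is below \<open>m\<close>, and
        \<open>j \<le> \<delta> - 1\<close> gives \<open>L + j \<le> m + 1\<close>.\<close>
      also have "\<dots> \<ge> ?v"
        using False j(2) assms by (intro nu_bound) auto
      finally show ?thesis .
    qed
  next
    show "?v \<in> ferrers_nu n ?F \<delta> ` {0..\<delta> - 1}"
      using nu0 by (intro image_eqI[of _ _ 0]) simp_all
  qed simp
qed

section \<open>The code for the given shape\<close>

theorem proposition3p15:
  fixes m n \<delta> l b q :: nat
  assumes "3 \<le> \<delta>" and "\<delta> \<le> n" and "n \<le> m"
    and "l = n - \<delta> + 1"
    and "b dvd m" and "b dvd l + 1"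
    and "primepow q" and "CARD('a::{field,finite}) = q"
  shows "\<exists>C :: 'a mat set.
    maximal_ferrers_code m n
      (ferrers_of_columns (replicate (l + 1 - b) b @ replicate b (l + 1) @ replicate (\<delta> - 2) m))
      \<delta> C"
proof -
  interpret prime_power_field "TYPE('a)"
    by unfold_locales (use assms in simp)
  let ?c = "column_list b (l + 1) (\<delta> - 2) m"
  let ?F = "ferrers_of_columns ?c"
  let ?v = "(l + 1 - b) * b + (b - 1) * (l + 1)"
  have b0: "b > 0" using assms(1-3,5) by (intro Nat.gr0I) auto
  have bl: "b \<le> l + 1" using assms(6) by (rule dvd_imp_le) simp
  have nl: "n = l + 1 + (\<delta> - 2)" "0 < l" "l \<le> n" "l + 1 \<le> m" "n - (l - 1) = \<delta>"
    using assms(1-4) by auto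
  have len: "length ?c = n" using length_column_list[OF bl] nl(1) by simp
  have nth: "?c ! t = (if t < l + 1 - b then b else if t < l + 1 then l + 1 else m)" if "t < n" for t
    using nth_column_list[OF bl] that nl(1) by simp
  have height: "?c ! t \<le> m" "1 \<le> ?c ! t" if "t < n" for t
    using nth[OF that] bl nl(4) b0 by auto
  have diagram: "ferrers_diagram m n ?F"
  proof (rule ferrers_diagram_ferrers_of_columns[OF len height(1)])
    fix t assume t: "Suc t < n"
    show "?c ! t \<le> ?c ! Suc t"
      using nth[OF t] nth[of t] t bl nl(4) by auto
  qed
  obtain e \<omega> V where bases:
    "fq_basis m e (GF m :: 'a alg_closure set)" "fq_basis m \<omega> (GF m :: 'a alg_closure set)"
    "fq_basis b \<omega> (GF b)" "fq_basis (l + 1) \<omega> V" "V \<subseteq> GF m"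
    and count: "CARD('a) ^ ((l + 1 - b) * b + (l + 1) * b) \<le> CARD('a) ^ (l + 1) *
      card {f \<in> {..<l} \<rightarrow>\<^sub>E GF m. \<forall>i<l + 1. qpoly l f (e i) \<in> (if i < l + 1 - b then GF b else V)}"
    by (rule exists_evaluation_bases[OF b0 assms(5,6) nl(2,4)])
  interpret evaluation_code "TYPE('a)" m n l e \<omega> ?F
    by unfold_locales (use bases nl assms(3) in simp_all)
  let ?N = "{f \<in> {..<l} \<rightarrow>\<^sub>E GF m. \<forall>i<l + 1. qpoly l f (e i) \<in> (if i < l + 1 - b then GF b else V)}"
  \<comment> \<open>The exponent exceeds the target dimension \<open>?v\<close> by exactly the
    \<open>l + 1\<close> lost to the top coefficient, so \<open>q ^ (l + 1)\<close> cancels.\<close>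
  have "(l + 1 - b) * b + (l + 1) * b = (l + 1) + ?v"
    using b0 by (cases b) simp_all
  with count have "CARD('a) ^ (l + 1) * CARD('a) ^ ?v \<le> CARD('a) ^ (l + 1) * card ?N"
    by (simp only: power_add)
  then have "CARD('a) ^ ?v \<le> card ?N" by simp
  also have "card ?N \<le> card code"
  proof (rule card_code_ge)
    show "?N \<subseteq> {..<l} \<rightarrow>\<^sub>E UNIV"
      by (rule subset_trans[OF Collect_restrict PiE_mono]) simp
    fix f j assume f: "f \<in> ?N" and j: "j < n"
    show "qpoly l f (e j) \<in> GF m"
      using f j assms(3) by (intro qpoly_in_GF fq_basis_mem[OF bases(1)]) auto
    fix i v assume i: "i < m" and eq: "qpoly l f (e j) = comb m \<omega> v" and "v i \<noteq> 0"
    \<comment> \<open>In the first \<open>l + 1\<close> columns the value lies in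
      \<open>GF b\<close> or \<open>V\<close>, spanned by the first \<open>b\<close> or
      \<open>l + 1\<close> vectors of \<open>\<omega>\<close>; the remaining columns have full
      height \<open>m\<close>.\<close>
    have "i < ?c ! j"
    proof (cases "j < l + 1")
      case True
      then have val: "comb m \<omega> v \<in> (if j < l + 1 - b then GF b else V)"
        using f unfolding eq[symmetric] by blast
      show ?thesis
      proof (rule ccontr)
        assume "\<not> i < ?c ! j"
        then have le: "(if j < l + 1 - b then b else l + 1) \<le> i"
          using nth[OF j] True by (simp split: if_splits)
        have "b \<le> m" using bl nl(4) by simp
        then have "v i = 0"
          using fq_basis_segment_coords[OF bases(2,3) _ _ _ i, of v]
            fq_basis_segment_coords[OF bases(2,4) nl(4) _ _ i, of v] val le
          by (cases "j < l + 1 - b") simp_all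
        with \<open>v i \<noteq> 0\<close> show False ..
      qed
    next
      case False
      moreover from this have "\<not> j < l + 1 - b" by linarith
      ultimately show ?thesis using nth[OF j] i by simp
    qed
    then show "(Suc i, Suc j) \<in> ?F"
      using j len by (simp only: mem_ferrers_of_columns_Suc)
  qed
  finally have ge: "CARD('a) ^ ?v \<le> card code" .
  \<comment> \<open>Cells are counted column by column, so the column index comes first.\<close>
  have "positions = (\<lambda>(j, i). (i, j)) ` (SIGMA j:{..<l}. {..<?c ! j})"
  proof (intro equalityI subsetI)
    fix p assume "p \<in> positions"
    then obtain i j where "p = (i, j)" "j < l" "i < ?c ! j"
      unfolding positions_def mem_ferrers_of_columns_Suc by blast
    then have "p = (\<lambda>(j, i). (i, j)) (j, i)" "(j, i) \<in> (SIGMA j:{..<l}. {..<?c ! j})" by simp_all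
    then show "p \<in> (\<lambda>(j, i). (i, j)) ` (SIGMA j:{..<l}. {..<?c ! j})" by (rule image_eqI)
  next
    fix p assume "p \<in> (\<lambda>(j, i). (i, j)) ` (SIGMA j:{..<l}. {..<?c ! j})"
    then obtain i j where p: "p = (i, j)" "j < l" "i < ?c ! j" by auto
    moreover have "j < n" using p(2) nl(3) by simp
    moreover have "i < m" using p(3) height(1)[OF \<open>j < n\<close>] by simp
    ultimately show "p \<in> positions"
      unfolding positions_def mem_ferrers_of_columns_Suc using len by simp
  qed
  moreover have "inj_on (\<lambda>(j, i). (i, j)) (SIGMA j:{..<l}. {..<?c ! j})"
    by (auto simp: inj_on_def)
  ultimately have "card positions = card (SIGMA j:{..<l}. {..<?c ! j})"
    by (simp only: card_image)
  also have "\<dots> = (\<Sum>j<l. ?c ! j)" by (simp add: card_SigmaI)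
  also have "\<dots> = ?v" by (rule sum_column_list_0[OF b0 bl])
  finally have pos: "card positions = ?v" .
  have "l - 1 < n" using nl(2,3) by simp
  have "(1, l) = (Suc 0, Suc (l - 1))" using nl(2) by simp
  moreover have "(Suc 0, Suc (l - 1)) \<in> ?F"
    unfolding mem_ferrers_of_columns_Suc using height(2)[OF \<open>l - 1 < n\<close>] \<open>l - 1 < n\<close> len by simp
  ultimately have top: "(1, l) \<in> ?F" by (simp only:)
  note full = full_code[unfolded pos, OF ge top]
  have lower: "\<delta> \<le> vec_space.rank m A" if "A \<in> code - {0\<^sub>m m n}" for A
    using code_rank_ge[of A] that nl(5) by simp
  obtain A where A: "A \<in> code - {0\<^sub>m m n}" "vec_space.rank m A \<le> n - (l - 1)"
    using full(2) by (rule bexE)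
  \<comment> \<open>The general lower bound and the special codeword meet because
    \<open>n - (l - 1) = \<delta>\<close>.\<close>
  have "vec_space.rank m A = \<delta>" using lower[OF A(1)] A(2) nl(5) by simp
  then have distance: "has_rank_distance m n code \<delta>"
    unfolding has_rank_distance_def using A(1) lower by (intro conjI bexI[of _ A] ballI)
  \<comment> \<open>The dimension is read off from the cardinality of the code by comparing
    exponents.\<close>
  have "CARD('a) ^ vectorspace.dim class_ring ((mat_space TYPE('a) m n)\<lparr>carrier := code\<rparr>) = CARD('a) ^ ?v"
    using card_mat_subspace[OF subspace_code finite_code] full(1) by simp
  then have "vectorspace.dim class_ring ((mat_space TYPE('a) m n)\<lparr>carrier := code\<rparr>) = ?v"
    by (rule power_inject_exp[OF CARD_field_gt_1, THEN iffD1])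
  moreover have "ferrers_nu_min n ?F \<delta> = ?v"
    by (rule ferrers_nu_min_eq[OF b0 assms(5,6,4,1,2,3)])
  moreover have "ferrers_code m n ?F \<delta> code"
    unfolding ferrers_code_def using diagram subspace_code distance codeD(3) by simp
  ultimately have "maximal_ferrers_code m n ?F \<delta> code"
    unfolding maximal_ferrers_code_def by simp
  then show ?thesis unfolding column_list_def by (rule exI)
qed

end
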